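(* $\hat\gamma^{(2)}_{\mathbb G_3}(0;e_2)>\gamma_{\mathbb G_3}(0;e_2)$. In particular, $\hat\kappa_{\mathbb G_3}(0;e_2)>\gamma_{\mathbb G_3}(0;e_2)$ and hence $k_{\mathbb G_3}(0,\cdot)\neq c_{\mathbb G_3}(0,\cdot)$ (as functions on $\mathbb G_3$).
   Context: $\mathbb D$ is the open unit disc in $\mathbb C$, and $\mathcal O(A,B)$ is the set of holomorphic maps $A\to B$. The symmetrized three-disc is the domain $\mathbb G_3=\{(t_1+t_2+t_3,\ t_1t_2+t_1t_3+t_2t_3,\ t_1t_2t_3): t_1,t_2,t_3\in\mathbb D\}\subset\mathbb C^3$, and $e_1,e_2,e_3$ is the standard basis of $\mathbb C^3$. For a domain $D\subset\mathbb C^n$, $z,w\in D$, $X\in\mathbb C^n$, define: the Carathéodory pseudodistance $c_D(z,w)=\sup\{\tanh^{-1}|f(w)|: f\in\mathcal O(D,\mathbb D), f(z)=0\}$; the Carathéodory–Reiffen pseudometric $\gamma_D(z;X)=\sup\{|f'(z)X|: f\in\mathcal O(D,\mathbb D), f(z)=0\}$; the Lempert function $\tilde k_D(z,w)=\inf\{\tanh^{-1}|\alpha|: \exists\varphi\in\mathcal O(\mathbb D,D),\ \varphi(0)=z,\ \varphi(\alpha)=w\}$; the Kobayashi–Royden pseudometric $\kappa_D(z;X)=\inf\{\alpha\ge 0: \exists\varphi\in\mathcal O(\mathbb D,D),\ \varphi(0)=z,\ \alpha\varphi'(0)=X\}$; the Kobayashi pseudodistance $k_D$, which is the largest pseudodistance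 on $D$ not exceeding $\tilde k_D$; the Kobayashi–Buseman pseudometric $\hat\kappa_D$, where $\hat\kappa_D(z;\cdot)$ is the largest (complex) pseudonorm on $\mathbb C^n$ not exceeding $\kappa_D(z;\cdot)$; for $k\in\mathbb N$, the $k$-th Reiffen pseudometric $\gamma^{(k)}_D(z;X)=\sup\left\{\left|\frac{f^{(k)}(z)X}{k!}\right|^{1/k}: f\in\mathcal O(D,\mathbb D),\ \mathrm{ord}_z f\ge k\right\}$, where $\mathrm{ord}_zf$ is the vanishing order of $f$ at $z$ and $f^{(k)}(z)X=\frac{d^k}{dt^k}f(z+tX)\big|_{t=0}$; $\hat\gamma^{(k)}_D$, where $\hat\gamma^{(k)}_D(z;\cdot)$ is the largest (complex) pseudonorm on $\mathbb C^n$ not exceeding $\gamma^{(k)}_D(z;\cdot)$. *)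

theory Defs
  imports "HOL-Complex_Analysis.Complex_Analysis"
begin

abbreviation unit_disc :: "complex set" where
  "unit_disc \<equiv> ball 0 1"

text \<open>
  Invariant functions and metrics are valued in \<^typ>\<open>ennreal\<close>, so that the suprema and infima
  below need no side condition. Holomorphy in several variables is complex Frechet
  differentiability; all definitions are meant for \<open>D\<close> open and connected.
\<close>

definition hol_to_disc :: "(complex ^ 'n) set \<Rightarrow> (complex ^ 'n \<Rightarrow> complex) set" where
  "hol_to_disc D =
     {f. (\<forall>z\<in>D. \<exists>f'. (f has_derivative f') (at z) \<and> (\<forall>c v. f' (c *s v) = c * f' v)) \<and>
         f ` D \<subseteq> unit_disc}"

definition hol_discs :: "(complex ^ 'n) set \<Rightarrow> (complex \<Rightarrow> complex ^ 'n) set" where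
  "hol_discs D =
     {\<phi>. (\<forall>i. (\<lambda>\<zeta>. \<phi> \<zeta> $ i) holomorphic_on unit_disc) \<and> \<phi> ` unit_disc \<subseteq> D}"

definition disc_deriv :: "(complex \<Rightarrow> complex ^ 'n) \<Rightarrow> complex \<Rightarrow> complex ^ 'n" where
  "disc_deriv \<phi> \<zeta> = (\<chi> i. deriv (\<lambda>\<xi>. \<phi> \<xi> $ i) \<zeta>)"

definition dir_deriv :: "nat \<Rightarrow> (complex ^ 'n \<Rightarrow> complex) \<Rightarrow> complex ^ 'n \<Rightarrow> complex ^ 'n \<Rightarrow> complex" where
  "dir_deriv k f z X = (deriv ^^ k) (\<lambda>t. f (z + t *s X)) 0"

text \<open>The degree of the first nonzero term in the expansion of \<open>f\<close> at \<open>z\<close> into homogeneous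
  polynomials \<open>X \<mapsto> dir_deriv j f z X / fact j\<close>; it is \<open>\<infinity>\<close> if there is none.\<close>

definition vanishing_order :: "(complex ^ 'n \<Rightarrow> complex) \<Rightarrow> complex ^ 'n \<Rightarrow> enat" where
  "vanishing_order f z = Inf (enat ` {j. \<exists>X. dir_deriv j f z X \<noteq> 0})"

definition caratheodory :: "(complex ^ 'n) set \<Rightarrow> complex ^ 'n \<Rightarrow> complex ^ 'n \<Rightarrow> ennreal" where
  "caratheodory D z w =
     Sup {ennreal (artanh (cmod (f w))) | f. f \<in> hol_to_disc D \<and> f z = 0}"

definition caratheodory_reiffen :: "(complex ^ 'n) set \<Rightarrow> complex ^ 'n \<Rightarrow> complex ^ 'n \<Rightarrow> ennreal" where
  "caratheodory_reiffen D z X =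
     Sup {ennreal (cmod (frechet_derivative f (at z) X)) | f. f \<in> hol_to_disc D \<and> f z = 0}"

definition reiffen :: "nat \<Rightarrow> (complex ^ 'n) set \<Rightarrow> complex ^ 'n \<Rightarrow> complex ^ 'n \<Rightarrow> ennreal" where
  "reiffen k D z X =
     Sup {ennreal (root k (cmod (dir_deriv k f z X / fact k))) | f.
            f \<in> hol_to_disc D \<and> vanishing_order f z \<ge> enat k}"

definition lempert :: "(complex ^ 'n) set \<Rightarrow> complex ^ 'n \<Rightarrow> complex ^ 'n \<Rightarrow> ennreal" where
  "lempert D z w =
     Inf {ennreal (artanh (cmod \<alpha>)) | \<alpha>.
            \<alpha> \<in> unit_disc \<and> (\<exists>\<phi>\<in>hol_discs D. \<phi> 0 = z \<and> \<phi> \<alpha> = w)}"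

definition kobayashi_royden :: "(complex ^ 'n) set \<Rightarrow> complex ^ 'n \<Rightarrow> complex ^ 'n \<Rightarrow> ennreal" where
  "kobayashi_royden D z X =
     Inf {ennreal \<alpha> | \<alpha>. \<alpha> \<ge> 0 \<and> (\<exists>\<phi>\<in>hol_discs D. \<phi> 0 = z \<and> \<alpha> *\<^sub>R disc_deriv \<phi> 0 = X)}"

text \<open>Pseudonorms and pseudodistances may formally take the value \<open>\<infinity>\<close>; this is immaterial for
  those lying below a finite function, which are the only ones of interest.\<close>

definition pseudonorm :: "(complex ^ 'n \<Rightarrow> ennreal) \<Rightarrow> bool" where
  "pseudonorm N \<longleftrightarrow>
     (\<forall>c X. N (c *s X) = ennreal (cmod c) * N X) \<and> (\<forall>X Y. N (X + Y) \<le> N X + N Y)"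

definition pseudodistance_on :: "'a set \<Rightarrow> ('a \<Rightarrow> 'a \<Rightarrow> ennreal) \<Rightarrow> bool" where
  "pseudodistance_on D d \<longleftrightarrow>
     (\<forall>x\<in>D. d x x = 0) \<and> (\<forall>x\<in>D. \<forall>y\<in>D. d x y = d y x) \<and>
     (\<forall>x\<in>D. \<forall>y\<in>D. \<forall>z\<in>D. d x z \<le> d x y + d y z)"

definition largest_pseudonorm :: "(complex ^ 'n \<Rightarrow> ennreal) \<Rightarrow> complex ^ 'n \<Rightarrow> ennreal" where
  "largest_pseudonorm p = (GREATEST N. pseudonorm N \<and> (\<forall>X. N X \<le> p X))"

text \<open>Outside \<open>D \<times> D\<close> the maximal \<open>d\<close> below is \<open>\<infinity>\<close>.\<close>

definition kobayashi :: "(complex ^ 'n) set \<Rightarrow> complex ^ 'n \<Rightarrow> complex ^ 'n \<Rightarrow> ennreal" where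
  "kobayashi D =
     (GREATEST d. pseudodistance_on D d \<and> (\<forall>z\<in>D. \<forall>w\<in>D. d z w \<le> lempert D z w))"

definition kobayashi_buseman :: "(complex ^ 'n) set \<Rightarrow> complex ^ 'n \<Rightarrow> complex ^ 'n \<Rightarrow> ennreal" where
  "kobayashi_buseman D z = largest_pseudonorm (kobayashi_royden D z)"

definition reiffen_hat :: "nat \<Rightarrow> (complex ^ 'n) set \<Rightarrow> complex ^ 'n \<Rightarrow> complex ^ 'n \<Rightarrow> ennreal" where
  "reiffen_hat k D z = largest_pseudonorm (reiffen k D z)"

definition symmetrized_three_disc :: "(complex ^ 3) set" where
  "symmetrized_three_disc =
     {vector [t1 + t2 + t3, t1 * t2 + t1 * t3 + t2 * t3, t1 * t2 * t3] | t1 t2 t3.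
        t1 \<in> unit_disc \<and> t2 \<in> unit_disc \<and> t3 \<in> unit_disc}"

text \<open>The two greatest elements above exist, as pointwise suprema.\<close>

lemma largest_pseudonorm_eq_SUP:
  "largest_pseudonorm p = (\<lambda>X. SUP N\<in>{N. pseudonorm N \<and> (\<forall>X. N X \<le> p X)}. N X)"
  unfolding largest_pseudonorm_def
proof (rule Greatest_equality)
  let ?A = "{N. pseudonorm N \<and> (\<forall>X. N X \<le> p X)}"
  have "pseudonorm (\<lambda>X. SUP N\<in>?A. N X)"
  proof (intro pseudonorm_def[THEN iffD2] conjI allI)
    fix c X
    show "(SUP N\<in>?A. N (c *s X)) = ennreal (cmod c) * (SUP N\<in>?A. N X)"
      by (subst SUP_mult_left_ennreal, rule SUP_cong[OF refl]) (auto simp: pseudonorm_def)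
  next
    fix X Y
    show "(SUP N\<in>?A. N (X + Y)) \<le> (SUP N\<in>?A. N X) + (SUP N\<in>?A. N Y)"
    proof (rule SUP_least)
      fix N assume N: "N \<in> ?A"
      then have "N (X + Y) \<le> N X + N Y" by (auto simp: pseudonorm_def)
      also have "\<dots> \<le> (SUP N\<in>?A. N X) + (SUP N\<in>?A. N Y)"
        by (intro add_mono SUP_upper N)
      finally show "N (X + Y) \<le> (SUP N\<in>?A. N X) + (SUP N\<in>?A. N Y)" .
    qed
  qed
  then show "pseudonorm (\<lambda>X. SUP N\<in>?A. N X) \<and> (\<forall>X. (SUP N\<in>?A. N X) \<le> p X)"
    by (auto intro: SUP_least)
qed (auto simp: le_fun_def intro: SUP_upper)

lemma kobayashi_eq_SUP:
  "kobayashi D = (\<lambda>x y. SUP d\<in>{d. pseudodistance_on D d \<and>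
     (\<forall>z\<in>D. \<forall>w\<in>D. d z w \<le> lempert D z w)}. d x y)"
  unfolding kobayashi_def
proof (rule Greatest_equality)
  let ?A = "{d. pseudodistance_on D d \<and> (\<forall>z\<in>D. \<forall>w\<in>D. d z w \<le> lempert D z w)}"
  have "pseudodistance_on D (\<lambda>x y. SUP d\<in>?A. d x y)"
  proof (intro pseudodistance_on_def[THEN iffD2] conjI ballI)
    fix x assume "x \<in> D"
    then have "(SUP d\<in>?A. d x x) \<le> 0"
      by (intro SUP_least) (auto simp: pseudodistance_on_def)
    then show "(SUP d\<in>?A. d x x) = 0" by simp
  next
    fix x y assume "x \<in> D" "y \<in> D"
    then show "(SUP d\<in>?A. d x y) = (SUP d\<in>?A. d y x)"
      by (intro SUP_cong[OF refl]) (auto simp: pseudodistance_on_def)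
  next
    fix x y z assume D: "x \<in> D" "y \<in> D" "z \<in> D"
    show "(SUP d\<in>?A. d x z) \<le> (SUP d\<in>?A. d x y) + (SUP d\<in>?A. d y z)"
    proof (rule SUP_least)
      fix d assume d: "d \<in> ?A"
      then have "d x z \<le> d x y + d y z" using D by (auto simp: pseudodistance_on_def)
      also have "\<dots> \<le> (SUP d\<in>?A. d x y) + (SUP d\<in>?A. d y z)"
        by (intro add_mono SUP_upper d)
      finally show "d x z \<le> (SUP d\<in>?A. d x y) + (SUP d\<in>?A. d y z)" .
    qed
  qed
  then show "pseudodistance_on D (\<lambda>x y. SUP d\<in>?A. d x y) \<and>
      (\<forall>z\<in>D. \<forall>w\<in>D. (SUP d\<in>?A. d z w) \<le> lempert D z w)"
    by (auto intro: SUP_least)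
qed (auto simp: le_fun_def intro: SUP_upper)

end

theory Submission imports Defs begin

text \<open>
  Only the part of weight two, \<open>a z2 + b z1\<^sup>2\<close>, of a function \<open>f\<close> matters for
  \<open>f' 0 e\<^sub>2 = a\<close>, and evaluating it at two points of the torus gives
  \<open>|a| \<le> 4505/5488 < 0.821\<close>. On the other hand the polynomial
  \<open>0.675 z2\<^sup>2 - 0.291 z1\<^sup>2 z2 + 0.033 z1\<^sup>4\<close> of weight four maps the domain into the
  disc, vanishes to order two at \<open>0\<close>, and has the quadratic part \<open>0.675 X2\<^sup>2\<close>. So the
  seminorm \<open>sqrt 0.675 |X2|\<close> lies below the second Reiffen pseudometric and, by the Schwarz
  lemma, below the Kobayashi-Royden pseudometric, while \<open>sqrt 0.675 > 0.8215\<close>. The estimate for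
  discs persists for centres near \<open>0\<close>, which separates the two distances at \<open>t e\<^sub>2\<close> for
  small \<open>t\<close>.
\<close>

text \<open>The maps (z1, z2, z3) -> (c z1, c^2 z2, c^3 z3) with |c| \<le> 1 preserve the domain, so
  competitors may be sought among polynomials homogeneous for these weights. In weight two these are
  the combinations of z2 and z1^2. Their squares give nothing beyond the Caratheodory-Reiffen
  metric; the gain is possible because a combination of z2^2, z1^2 z2, z1^4 need not be such a
  square (for \<open>quartic\<close>, 291^2 \<noteq> 4 * 675 * 33). The monomial z1 z3 of the same
  weight is avoided, so that the quadratic part is a pure square and its root is a seminorm without
  convexification. For the distances, discs centred at 0 do not suffice, since the Kobayashi
  distance is built from chains of discs with arbitrary centres. Instead of following chains, the
  proof exhibits a real function whose differences are dominated by the Lempert function: these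
  differences form a pseudodistance, hence lie below the greatest one.\<close>

no_notation fps_nth (infixl "$" 75)

subsection \<open>A polynomial of weight four\<close>

text \<open>The coefficient 675/1000 is just above (4505/5488)^2, about 0.6738. The absolute values
  of the coefficients add up to 999/1000, which is the modulus at the torus point (1, 1, -1) and
  leaves the image strictly inside the disc. Scalar arguments allow the use on differences of
  points, which may lie outside the domain.\<close>

definition quartic :: "complex \<Rightarrow> complex \<Rightarrow> complex" where
  "quartic x y = (675 * y\<^sup>2 - 291 * (x\<^sup>2 * y) + 33 * x ^ 4) / 1000"

text \<open>The chord over [l, u] exceeds the parabola by
  \<open>A * (y - l) * (u - y)\<close>.\<close>

lemma quadratic_le_endpoints:
  fixes A B C l u y M :: real
  assumes "0 \<le> A" "l \<le> y" "y \<le> u"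
    and "A * l\<^sup>2 + B * l + C \<le> M" "A * u\<^sup>2 + B * u + C \<le> M"
  shows "A * y\<^sup>2 + B * y + C \<le> M"
proof (cases "l = u")
  case True
  with assms show ?thesis by simp
next
  case False
  with assms have lu: "l < u" by simp
  have "(u - l) * (A * y\<^sup>2 + B * y + C - M) =
      (u - y) * (A * l\<^sup>2 + B * l + C - M) + (y - l) * (A * u\<^sup>2 + B * u + C - M)
      - A * ((u - l) * ((y - l) * (u - y)))"
    by (simp add: algebra_simps power2_eq_square)
  also have "\<dots> \<le> 0"
  proof -
    have "(u - y) * (A * l\<^sup>2 + B * l + C - M) \<le> 0"
      using assms by (intro mult_nonneg_nonpos) auto
    moreover have "(y - l) * (A * u\<^sup>2 + B * u + C - M) \<le> 0"
      using assms by (intro mult_nonneg_nonpos) auto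
    moreover have "A * ((u - l) * ((y - l) * (u - y))) \<ge> 0"
      using assms lu by (intro mult_nonneg_nonneg) auto
    ultimately show ?thesis by linarith
  qed
  finally show ?thesis
    using lu by (simp add: mult_le_0_iff)
qed

text \<open>With x = a + b + c and z = a b c, the cubic with roots a, b, c has discriminant z^2
  times \<open>s\<^sup>2 + 18 * s - 27 - 8 * m\<close>. Each of the three factors (a - b)^2 / (a b)
  of the quotient equals -|a - b|^2 on the circle, so the quotient is not positive.\<close>

lemma torus_discriminant:
  fixes a b c :: complex
  assumes "cmod a = 1" "cmod b = 1" "cmod c = 1"
  defines "s \<equiv> (cmod (a + b + c))\<^sup>2" and "m \<equiv> Re ((a + b + c) ^ 3 * cnj (a * b * c))"
  shows "s\<^sup>2 + 18 * s - 27 \<le> 8 * m"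
proof -
  \<comment> \<open>The conjugates become variables tied only by \<open>a * a' = 1\<close>, so that
    the identity is polynomial and \<open>algebra\<close> proves it.\<close>
  define a' b' c' where "a' = cnj a" "b' = cnj b" "c' = cnj c"
  have inv: "a * a' = 1" "b * b' = 1" "c * c' = 1"
    using assms by (simp_all add: a'_b'_c'_def complex_mult_cnj cmod_def)
  define S where "S = (a + b + c) * (a' + b' + c')"
  have S: "S = complex_of_real s"
    unfolding S_def s_def a'_b'_c'_def by (simp only: complex_norm_square complex_cnj_add)
  define W where "W = (a + b + c) ^ 3 * (a' * b' * c')"
  have W: "W + cnj W = complex_of_real (2 * m)"
    by (subst complex_add_cnj) (simp add: m_def W_def a'_b'_c'_def)
  have cnjW: "cnj W = (a' + b' + c') ^ 3 * (a * b * c)"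
    unfolding W_def a'_b'_c'_def by simp
  have WW: "4 * ((a + b + c) ^ 3 * (a' * b' * c') + (a' + b' + c') ^ 3 * (a * b * c)) =
      complex_of_real (8 * m)"
    using W unfolding cnjW unfolding W_def by simp
  have "4 * ((a + b + c) ^ 3 * (a' * b' * c') + (a' + b' + c') ^ 3 * (a * b * c))
        - (((a + b + c) * (a' + b' + c'))\<^sup>2 + 18 * ((a + b + c) * (a' + b' + c')) - 27)
        = ((a - b) * (a' - b')) * ((b - c) * (b' - c')) * ((a - c) * (a' - c'))"
    using inv by algebra
  then have "complex_of_real (8 * m - (s\<^sup>2 + 18 * s - 27)) =
      complex_of_real ((cmod (a - b))\<^sup>2 * (cmod (b - c))\<^sup>2 * (cmod (a - c))\<^sup>2)"
    using S WW unfolding S_def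
    by (simp add: a'_b'_c'_def complex_norm_square del: of_real_power flip: of_real_power)
  then have "8 * m - (s\<^sup>2 + 18 * s - 27) = (cmod (a - b))\<^sup>2 * (cmod (b - c))\<^sup>2 * (cmod (a - c))\<^sup>2"
    using of_real_eq_iff by blast
  also have "\<dots> \<ge> 0" by simp
  finally show ?thesis by linarith
qed


text \<open>On the torus \<open>y = z cnj x\<close>, where \<open>z = a b c\<close>, so the modulus of \<open>quartic x y\<close>
  depends only on \<open>s\<close> and \<open>m\<close>; it is convex in \<open>m\<close>, whose range is bounded below by
  the discriminant and above by \<open>m\<^sup>2 \<le> s\<^sup>3\<close>.\<close>

lemma cmod_quartic_torus:
  fixes x z :: complex
  assumes "cmod z = 1"
  defines "s \<equiv> (cmod x)\<^sup>2" and "m \<equiv> Re (x ^ 3 * cnj z)"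
  shows "(1000 * cmod (quartic x (z * cnj x)))\<^sup>2 =
    4 * 675 * 33 * m\<^sup>2 + 2 * (- 675 * 291 * s - 291 * 33 * s\<^sup>2) * m
    + (675\<^sup>2 * s\<^sup>2 + 291\<^sup>2 * s ^ 3 + 33\<^sup>2 * s ^ 4 - 2 * 675 * 33 * s ^ 3)"
proof -
  define x' z' where "x' = cnj x" "z' = cnj z"
  have zz: "z * z' = 1"
    using assms(1) by (simp add: x'_z'_def complex_mult_cnj cmod_def)
  have S: "complex_of_real s = x * x'"
    unfolding s_def x'_z'_def by (rule complex_norm_square)
  have M: "complex_of_real (2 * m) = x ^ 3 * z' + x' ^ 3 * z"
    using complex_add_cnj[of "x ^ 3 * cnj z"] by (simp add: m_def x'_z'_def)
  have "complex_of_real ((1000 * cmod (quartic x (z * cnj x)))\<^sup>2) =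
      (1000 * quartic x (z * x')) * cnj (1000 * quartic x (z * x'))"
    by (simp only: complex_norm_square[symmetric] norm_mult) (simp add: x'_z'_def)
  also have "\<dots> = (675 * (z * x')\<^sup>2 - 291 * (x\<^sup>2 * (z * x')) + 33 * x ^ 4) *
      (675 * (z' * x)\<^sup>2 - 291 * (x'\<^sup>2 * (z' * x)) + 33 * x' ^ 4)"
  proof -
    have "1000 * quartic x (z * x') = 675 * (z * x')\<^sup>2 - 291 * (x\<^sup>2 * (z * x')) + 33 * x ^ 4"
      by (simp add: quartic_def)
    then show ?thesis by (simp add: x'_z'_def)
  qed
  also have "\<dots> = 675 * 33 * (x ^ 3 * z' + x' ^ 3 * z)\<^sup>2 +
      (- 675 * 291 * (x * x') - 291 * 33 * (x * x')\<^sup>2) * (x ^ 3 * z' + x' ^ 3 * z)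
      + (675\<^sup>2 * (x * x')\<^sup>2 + 291\<^sup>2 * (x * x') ^ 3 + 33\<^sup>2 * (x * x') ^ 4
         - 2 * 675 * 33 * (x * x') ^ 3)"
    using zz by algebra
  also have "\<dots> = complex_of_real (675 * 33 * (2 * m)\<^sup>2 +
      (- 675 * 291 * s - 291 * 33 * s\<^sup>2) * (2 * m)
      + (675\<^sup>2 * s\<^sup>2 + 291\<^sup>2 * s ^ 3 + 33\<^sup>2 * s ^ 4 - 2 * 675 * 33 * s ^ 3))"
    unfolding S[symmetric] M[symmetric] by simp
  finally show ?thesis
    unfolding of_real_eq_iff by (simp add: algebra_simps power2_eq_square)
qed

lemma quartic_torus:
  fixes a b c :: complex
  assumes abc: "cmod a = 1" "cmod b = 1" "cmod c = 1"
  shows "cmod (quartic (a + b + c) (a * b + a * c + b * c)) \<le> 999 / 1000"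
proof -
  define x z where "x = a + b + c" "z = a * b * c"
  define r where "r = cmod x"
  define m where "m = Re (x ^ 3 * cnj z)"
  have z: "cmod z = 1" using abc by (simp add: x_z_def norm_mult)
  have "a * cnj a = 1" "b * cnj b = 1" "c * cnj c = 1"
    using abc by (simp_all add: complex_mult_cnj cmod_def)
  then have y: "a * b + a * c + b * c = z * cnj x"
    unfolding x_z_def complex_cnj_add by algebra
  have r0: "0 \<le> r" by (simp add: r_def)
  have r3: "r \<le> 3"
    using norm_triangle_ineq[of "a + b" c] norm_triangle_ineq[of a b] abc
    by (simp add: r_def x_z_def)
  have "\<bar>m\<bar> \<le> cmod (x ^ 3 * cnj z)" unfolding m_def by (rule abs_Re_le_cmod)
  also have "\<dots> = r ^ 3" using z by (simp add: r_def norm_mult norm_power)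
  finally have m: "- (r ^ 3) \<le> m" "m \<le> r ^ 3" by linarith+
  have disc: "(r\<^sup>2)\<^sup>2 + 18 * r\<^sup>2 - 27 \<le> 8 * m"
    using torus_discriminant[OF abc] by (simp add: r_def m_def x_z_def)
  define A B C :: real where
    "A = 4 * 675 * 33" and
    "B = 2 * (- 675 * 291 * r\<^sup>2 - 291 * 33 * (r\<^sup>2)\<^sup>2)" and
    "C = 675\<^sup>2 * (r\<^sup>2)\<^sup>2 + 291\<^sup>2 * (r\<^sup>2) ^ 3 + 33\<^sup>2 * (r\<^sup>2) ^ 4 - 2 * 675 * 33 * (r\<^sup>2) ^ 3"
  have pos: "0 \<le> 675 - 291 * r + 33 * r\<^sup>2"
  proof -
    have "0 \<le> 33 * (r - 291 / 66)\<^sup>2" by simp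
    then show ?thesis by (simp add: power2_eq_square algebra_simps)
  qed
  \<comment> \<open>For \<open>m = r ^ 3\<close> the monomials y^2, x^2 y, x^4 have the same
    argument, so the quadratic in \<open>m\<close> is a perfect square.\<close>
  have hi: "A * (r ^ 3)\<^sup>2 + B * r ^ 3 + C \<le> 999\<^sup>2"
  proof -
    have "r\<^sup>2 * (675 - 291 * r + 33 * r\<^sup>2) \<le> 999"
    proof (cases "r \<le> 1")
      case True
      have "r\<^sup>2 * (675 - r * (291 - 33 * r)) \<le> 1 * 675"
      proof (intro mult_mono power_le_one)
        have "0 \<le> r * (291 - 33 * r)" "r * (291 - 33 * r) \<le> 1 * 291"
          using True r0 by (intro mult_nonneg_nonneg mult_mono; simp)+
        then show "675 - r * (291 - 33 * r) \<le> 675" "0 \<le> 675 - r * (291 - 33 * r)" by linarith+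
      qed (use True r0 in auto)
      then show ?thesis by (simp add: algebra_simps power2_eq_square)
    next
      case False
      \<comment> \<open>On [0, 3] the quantity to be bounded has its maximum, about 962, near 5/2;
        splitting off (r - 5/2)^2 leaves a linear rest that is positive for r > 1.\<close>
      have "0 \<le> (r * (126 - 33 * r) + 645 / 4) * (r - 5 / 2)\<^sup>2"
        using r0 r3 by (intro mult_nonneg_nonneg add_nonneg_nonneg) auto
      moreover have "999 - r\<^sup>2 * (675 - 291 * r + 33 * r\<^sup>2) =
          (r * (126 - 33 * r) + 645 / 4) * (r - 5 / 2)\<^sup>2 + (75 / 4 * r - 141 / 16)"
        by (simp add: power2_eq_square algebra_simps)
      ultimately show ?thesis using False by linarith
    qed
    then have "(r\<^sup>2 * (675 - 291 * r + 33 * r\<^sup>2))\<^sup>2 \<le> 999\<^sup>2"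
      using pos by (intro power_mono) auto
    also have "(r\<^sup>2 * (675 - 291 * r + 33 * r\<^sup>2))\<^sup>2 = A * (r ^ 3)\<^sup>2 + B * r ^ 3 + C"
      unfolding A_def B_def C_def by algebra
    finally show ?thesis .
  qed
  \<comment> \<open>The discriminant bound minus \<open>- (r ^ 3)\<close> is
    \<open>(r - 1) * (r + 3) ^ 3 / 8\<close>, so the two lower bounds for \<open>m\<close> cross at
    \<open>r = 1\<close> and each case uses the sharper one.\<close>
  have "\<exists>l. l \<le> m \<and> A * l\<^sup>2 + B * l + C \<le> 999\<^sup>2"
  proof (cases "r \<le> 1")
    case True
    have "r\<^sup>2 * (675 + 291 * r + 33 * r\<^sup>2) \<le> 1 * (675 + 291 * 1 + 33 * 1)"
      using True r0 by (intro mult_mono add_mono order_refl power_le_one) auto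
    then have "(r\<^sup>2 * (675 + 291 * r + 33 * r\<^sup>2))\<^sup>2 \<le> 999\<^sup>2"
      using r0 by (intro power_mono) auto
    also have "(r\<^sup>2 * (675 + 291 * r + 33 * r\<^sup>2))\<^sup>2 = A * (- (r ^ 3))\<^sup>2 + B * (- (r ^ 3)) + C"
      unfolding A_def B_def C_def by algebra
    finally show ?thesis using m by blast
  next
    case False
    define s where "s = r\<^sup>2"
    define l where "l = (s\<^sup>2 + 18 * s - 27) / 8"
    have s1: "1 \<le> s" using False unfolding s_def by (intro one_le_power) auto
    have s9: "s \<le> 9" using power_mono[OF r3 r0, of 2] by (simp add: s_def)
    have "116 * s\<^sup>2 - 795 * s + 1539 = 116 * (s - 795 / 232)\<^sup>2 + (1539 - 795\<^sup>2 / 464)"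
      by (simp add: power2_eq_square algebra_simps)
    also have "\<dots> \<ge> 0" by simp
    finally have q: "0 \<le> 116 * s\<^sup>2 - 795 * s + 1539" .
    \<comment> \<open>The factor \<open>s - 1\<close> reflects equality at \<open>s = 1\<close>,
      where \<open>l = -1\<close> and the quadratic is 999^2. The cofactor is split into two
      summands that are visibly nonnegative on [1, 9].\<close>
    have "0 \<le> (s - 1) * (1287 * ((9 - s) * (s - 3)\<^sup>2) + 108 * (116 * s\<^sup>2 - 795 * s + 1539))"
      using s1 s9 by (intro mult_nonneg_nonneg add_nonneg_nonneg[OF _ mult_nonneg_nonneg[OF _ q]]) simp_all
    also have "\<dots> = 16 * (999\<^sup>2 - (A * l\<^sup>2 + B * l + C))"
    proof -
      have "8 * l = s\<^sup>2 + 18 * s - 27" by (simp add: l_def)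
      then show ?thesis unfolding A_def B_def C_def s_def[symmetric] by algebra
    qed
    finally have "A * l\<^sup>2 + B * l + C \<le> 999\<^sup>2" by simp
    moreover have "l \<le> m" using disc by (simp add: l_def s_def)
    ultimately show ?thesis by blast
  qed
  then obtain l where "l \<le> m" "A * l\<^sup>2 + B * l + C \<le> 999\<^sup>2" by blast
  then have "A * m\<^sup>2 + B * m + C \<le> 999\<^sup>2"
    using m hi by (intro quadratic_le_endpoints[of A l m "r ^ 3" B C]) (auto simp: A_def)
  then have "(1000 * cmod (quartic x (z * cnj x)))\<^sup>2 \<le> 999\<^sup>2"
    unfolding cmod_quartic_torus[OF z] A_def B_def C_def r_def m_def .
  then have "1000 * cmod (quartic x (z * cnj x)) \<le> 999"
    by (rule power2_le_imp_le) simp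
  then show ?thesis by (simp add: y x_z_def(1))
qed


section \<open>From the torus to the symmetrized three-disc\<close>

lemma max_modulus_unit_disc:
  assumes "h holomorphic_on UNIV" "\<And>z. cmod z = 1 \<Longrightarrow> cmod (h z) \<le> B" "cmod z \<le> 1"
  shows "cmod (h z) \<le> B"
proof (rule maximum_modulus_frontier[of h "cball 0 1" B z])
  show "h holomorphic_on interior (cball 0 1)"
    using assms(1) holomorphic_on_subset by blast
  show "continuous_on (closure (cball 0 1)) h"
    using assms(1) by (meson holomorphic_on_imp_continuous_on continuous_on_subset subset_UNIV)
qed (use assms in auto)

lemma quartic_holomorphic:
  assumes "f holomorphic_on S" "g holomorphic_on S"
  shows "(\<lambda>z. quartic (f z) (g z)) holomorphic_on S"
  unfolding quartic_def using assms by (intro holomorphic_intros) auto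

text \<open>The maximum principle moves one variable at a time from the circle into the
  disc.\<close>

lemma quartic_polydisc:
  assumes "cmod a \<le> 1" "cmod b \<le> 1" "cmod c \<le> 1"
  shows "cmod (quartic (a + b + c) (a * b + a * c + b * c)) \<le> 999 / 1000"
proof -
  let ?q = "\<lambda>a b c. quartic (a + b + c) (a * b + a * c + b * c)"
  have hol: "(\<lambda>a. ?q a b c) holomorphic_on UNIV" "(\<lambda>b. ?q a b c) holomorphic_on UNIV"
    "(\<lambda>c. ?q a b c) holomorphic_on UNIV" for a b c
    by (intro quartic_holomorphic holomorphic_intros)+
  have *: "cmod (?q a b c) \<le> 999 / 1000" if "cmod a \<le> 1" "cmod b = 1" "cmod c = 1" for a b c
    by (rule max_modulus_unit_disc[OF hol(1) _ that(1)]) (rule quartic_torus[OF _ that(2,3)])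
  have **: "cmod (?q a b c) \<le> 999 / 1000" if "cmod a \<le> 1" "cmod b \<le> 1" "cmod c = 1" for a b c
    by (rule max_modulus_unit_disc[OF hol(2) _ that(2)]) (rule *[OF that(1) _ that(3)])
  show ?thesis
    by (rule max_modulus_unit_disc[OF hol(3) _ assms(3)]) (rule **[OF assms(1,2)])
qed

lemma quartic_symmetrized_three_disc:
  assumes "z \<in> symmetrized_three_disc"
  shows "cmod (quartic (z $ 1) (z $ 2)) \<le> 999 / 1000"
proof -
  obtain a b c where "z = vector [a + b + c, a * b + a * c + b * c, a * b * c]"
    "cmod a < 1" "cmod b < 1" "cmod c < 1"
    using assms by (auto simp: symmetrized_three_disc_def)
  then show ?thesis using quartic_polydisc[of a b c] by simp
qed

lemma symmetrized_three_disc_bound: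
  assumes "z \<in> symmetrized_three_disc"
  shows "cmod (z $ 1) \<le> 3" "cmod (z $ 2) \<le> 3"
proof -
  obtain a b c where z: "z = vector [a + b + c, a * b + a * c + b * c, a * b * c]"
    and abc: "cmod a < 1" "cmod b < 1" "cmod c < 1"
    using assms by (auto simp: symmetrized_three_disc_def)
  have "cmod (a + b + c) \<le> cmod a + cmod b + cmod c"
    using norm_triangle_ineq[of "a + b" c] norm_triangle_ineq[of a b] by linarith
  then show "cmod (z $ 1) \<le> 3" using abc by (simp add: z)
  have "cmod (x * y) \<le> 1" if "cmod x < 1" "cmod y < 1" for x y
    using that by (simp add: norm_mult mult_le_one)
  then have "cmod (a * b) \<le> 1" "cmod (a * c) \<le> 1" "cmod (b * c) \<le> 1" using abc by blast+
  then have "cmod (a * b + a * c + b * c) \<le> 3"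
    using norm_triangle_ineq[of "a * b + a * c" "b * c"] norm_triangle_ineq[of "a * b" "a * c"]
    by linarith
  then show "cmod (z $ 2) \<le> 3" by (simp add: z)
qed

text \<open>The coordinates are, up to sign, the lower coefficients of a monic cubic. Being below
  1/3 they cannot balance the leading term where |t| \<ge> 1, so all roots lie in the disc. This
  makes 0 an interior point.\<close>

lemma mem_symmetrized_three_disc:
  assumes "cmod (z $ 1) < 1 / 3" "cmod (z $ 2) < 1 / 3" "cmod (z $ 3) < 1 / 3"
  shows "z \<in> symmetrized_three_disc"
proof -
  define p where "p t = t ^ 3 - z $ 1 * t\<^sup>2 + z $ 2 * t - z $ 3" for t
  define coef where "coef = nth [- z $ 3, z $ 2, - z $ 1, 1]"
  obtain a where "(\<Sum>i\<le>3. coef i * a ^ i) = 0"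
    by (rule fundamental_theorem_of_algebra[of coef 3]) (auto simp: coef_def intro!: bexI[of _ 3])
  then have a: "p a = 0"
    by (simp add: p_def coef_def eval_nat_numeral algebra_simps)
  \<comment> \<open>The other two roots are those of the quotient t^2 - u t + v.\<close>
  define u v d where "u = z $ 1 - a" and "v = z $ 2 - a * u" and "d = csqrt (u\<^sup>2 - 4 * v)"
  define b c where "b = (u + d) / 2" and "c = (u - d) / 2"
  have "b * c = (u\<^sup>2 - d\<^sup>2) / 4"
    by (simp add: b_def c_def power2_eq_square field_simps)
  then have bc: "b + c = u" "b * c = v"
    by (simp_all add: b_def c_def d_def field_simps)
  then have z12: "z $ 1 = a + b + c" "z $ 2 = a * b + a * c + b * c"
    unfolding u_def v_def by (simp add: algebra_simps, algebra)
  with a have z3: "z $ 3 = a * b * c" unfolding p_def by algebra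
  have z: "z = vector [a + b + c, a * b + a * c + b * c, a * b * c]"
    using z12 z3 by (simp add: vec_eq_iff forall_3)
  have roots: "cmod t < 1" if "p t = 0" for t
  proof (rule ccontr)
    assume "\<not> cmod t < 1"
    then have t: "1 \<le> cmod t" by simp
    have "t ^ 3 = z $ 1 * t\<^sup>2 - z $ 2 * t + z $ 3"
      using that by (simp add: p_def algebra_simps)
    then have "cmod t ^ 3 = cmod (z $ 1 * t\<^sup>2 - z $ 2 * t + z $ 3)"
      by (metis norm_power)
    also have "\<dots> \<le> cmod (z $ 1 * t\<^sup>2) + cmod (z $ 2 * t) + cmod (z $ 3)"
      using norm_triangle_ineq[of "z $ 1 * t\<^sup>2 - z $ 2 * t" "z $ 3"]
        norm_triangle_ineq4[of "z $ 1 * t\<^sup>2" "z $ 2 * t"] by linarith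
    also have "\<dots> = cmod (z $ 1) * cmod t ^ 2 + cmod (z $ 2) * cmod t + cmod (z $ 3)"
      by (simp add: norm_mult norm_power)
    also have "\<dots> < 1 / 3 * cmod t ^ 3 + 1 / 3 * cmod t ^ 3 + 1 / 3 * cmod t ^ 3"
    proof (intro add_strict_mono)
      have "cmod t ^ 2 \<le> cmod t ^ 3" using t by (intro power_increasing) auto
      then show "cmod (z $ 1) * cmod t ^ 2 < 1 / 3 * cmod t ^ 3"
        using assms t by (intro mult_less_le_imp_less) auto
      have "cmod t ^ 1 \<le> cmod t ^ 3" using t by (intro power_increasing) auto
      then show "cmod (z $ 2) * cmod t < 1 / 3 * cmod t ^ 3"
        using assms t by (intro mult_less_le_imp_less) auto
      have "1 \<le> cmod t ^ 3" using t by (intro one_le_power) auto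
      then show "cmod (z $ 3) < 1 / 3 * cmod t ^ 3" using assms by linarith
    qed
    finally show False by simp
  qed
  have "p a = 0" "p b = 0" "p c = 0"
    unfolding p_def z12 z3 by (algebra, algebra, algebra)
  then have "a \<in> unit_disc" "b \<in> unit_disc" "c \<in> unit_disc"
    using roots by simp_all
  then show ?thesis
    unfolding symmetrized_three_disc_def mem_Collect_eq
    by (intro exI[of _ a] exI[of _ b] exI[of _ c] conjI z)
qed

subsection \<open>Bounded holomorphic functions\<close>

lemma has_derivative_vec:
  fixes \<phi> :: "'a::real_normed_vector \<Rightarrow> 'b::euclidean_space ^ 'n"
  assumes "\<And>i. ((\<lambda>x. \<phi> x $ i) has_derivative (\<lambda>h. \<phi>' h $ i)) (at a within S)"
  shows "(\<phi> has_derivative \<phi>') (at a within S)"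
  unfolding has_derivative_componentwise_within[of \<phi>]
proof
  fix b :: "'b ^ 'n"
  assume "b \<in> Basis"
  then obtain i u where b: "b = axis i u" by (auto simp: Basis_vec_def)
  show "((\<lambda>x. \<phi> x \<bullet> b) has_derivative (\<lambda>x. \<phi>' x \<bullet> b)) (at a within S)"
    unfolding b inner_axis by (rule has_derivative_inner_left[OF assms])
qed

lemma hol_to_disc_frechet:
  assumes "f \<in> hol_to_disc D" "z \<in> D"
  shows "(f has_derivative frechet_derivative f (at z)) (at z)"
    and "frechet_derivative f (at z) (c *s v) = c * frechet_derivative f (at z) v"
    and "cmod (f z) < 1"
proof -
  obtain f' where f': "(f has_derivative f') (at z)" "\<And>c v. f' (c *s v) = c * f' v"
    using assms by (auto simp: hol_to_disc_def)
  have eq: "f' = frechet_derivative f (at z)" using f'(1) by (rule frechet_derivative_at)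
  show "(f has_derivative frechet_derivative f (at z)) (at z)"
    and "frechet_derivative f (at z) (c *s v) = c * frechet_derivative f (at z) v"
    using f' unfolding eq by blast+
  show "cmod (f z) < 1" using assms by (auto simp: hol_to_disc_def)
qed

text \<open>Complex linearity of the Frechet derivative of \<open>f\<close> turns the real chain
  rule into a complex derivative.\<close>

lemma hol_to_disc_compose:
  assumes f: "f \<in> hol_to_disc D" and S: "open S"
    and \<phi>: "\<And>i. (\<lambda>\<zeta>. \<phi> \<zeta> $ i) holomorphic_on S" "\<And>\<zeta>. \<zeta> \<in> S \<Longrightarrow> \<phi> \<zeta> \<in> D"
  shows "(\<lambda>\<zeta>. f (\<phi> \<zeta>)) holomorphic_on S"
    and "\<zeta> \<in> S \<Longrightarrow> deriv (\<lambda>\<zeta>. f (\<phi> \<zeta>)) \<zeta> = frechet_derivative f (at (\<phi> \<zeta>)) (disc_deriv \<phi> \<zeta>)"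
proof -
  have *: "((\<lambda>\<zeta>. f (\<phi> \<zeta>)) has_field_derivative frechet_derivative f (at (\<phi> \<zeta>)) (disc_deriv \<phi> \<zeta>)) (at \<zeta>)"
    if "\<zeta> \<in> S" for \<zeta>
  proof -
    have "(\<phi> has_derivative (\<lambda>h. h *s disc_deriv \<phi> \<zeta>)) (at \<zeta>)"
    proof (rule has_derivative_vec)
      fix i
      have "((\<lambda>\<zeta>. \<phi> \<zeta> $ i) has_field_derivative deriv (\<lambda>\<zeta>. \<phi> \<zeta> $ i) \<zeta>) (at \<zeta>)"
        using \<phi>(1) S that by (rule holomorphic_derivI)
      then show "((\<lambda>x. \<phi> x $ i) has_derivative (\<lambda>h. (h *s disc_deriv \<phi> \<zeta>) $ i)) (at \<zeta>)"
        by (simp add: has_field_derivative_def disc_deriv_def mult_commute_abs)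
    qed
    from has_derivative_compose[OF this hol_to_disc_frechet(1)[OF f \<phi>(2)[OF that]]]
    show ?thesis
      using hol_to_disc_frechet(2)[OF f \<phi>(2)[OF that]]
      by (simp add: has_field_derivative_def mult_commute_abs)
  qed
  show "(\<lambda>\<zeta>. f (\<phi> \<zeta>)) holomorphic_on S"
    using * S by (auto simp: holomorphic_on_open)
  show "\<zeta> \<in> S \<Longrightarrow> deriv (\<lambda>\<zeta>. f (\<phi> \<zeta>)) \<zeta> = frechet_derivative f (at (\<phi> \<zeta>)) (disc_deriv \<phi> \<zeta>)"
    using * by (rule DERIV_imp_deriv)
qed

text \<open>Since \<open>B\<close> is a nonstrict bound and may be 0, the Schwarz lemma is applied
  to \<open>g / (B + e)\<close> and \<open>e\<close> tends to 0.\<close>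

lemma Schwarz_quotient:
  assumes g: "g holomorphic_on ball 0 1" "g 0 = 0" and B: "\<And>z. cmod z < 1 \<Longrightarrow> cmod (g z) \<le> B"
  obtains h where "h holomorphic_on ball 0 1" "\<And>z. cmod z < 1 \<Longrightarrow> g z = z * h z"
    "deriv g 0 = h 0" "\<And>z. cmod z < 1 \<Longrightarrow> cmod (h z) \<le> B"
proof -
  obtain h where h: "h holomorphic_on ball 0 1" "\<And>z. cmod z < 1 \<Longrightarrow> g z = z * h z" "deriv g 0 = h 0"
    using Schwarz3[OF g] by blast
  have B0: "0 \<le> B" using B[of 0] g(2) by simp
  have "cmod (h z) \<le> B" if z: "cmod z < 1" for z
  proof (rule field_le_epsilon)
    fix e :: real assume e: "0 < e"
    define R where "R = B + e"
    define k where "k = (\<lambda>z. g z / of_real R)"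
    have R: "0 < R" "B < R" using B0 e by (simp_all add: R_def)
    have k: "k holomorphic_on ball 0 1" "k 0 = 0"
      using g R unfolding k_def by (auto intro!: holomorphic_intros)
    have k1: "cmod (k z) < 1" if "cmod z < 1" for z
      using B[OF that] R by (simp add: k_def norm_divide divide_less_eq)
    have "cmod (h z) \<le> R"
    proof (cases "z = 0")
      case True
      have "(g has_field_derivative h 0) (at 0)"
        using holomorphic_derivI[OF g(1), of 0] h(3) by simp
      then have "(k has_field_derivative h 0 / of_real R) (at 0)"
        unfolding k_def by (rule DERIV_cdivide)
      then have "deriv k 0 = h 0 / of_real R" by (rule DERIV_imp_deriv)
      then show ?thesis
        using Schwarz_Lemma(2)[OF k k1 z] R True by (simp add: norm_divide divide_le_eq)
    next
      case False
      have "cmod (k z) \<le> cmod z" by (rule Schwarz_Lemma(1)[OF k k1 z])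
      then have "cmod (g z) \<le> R * cmod z"
        using R by (simp add: k_def norm_divide divide_le_eq mult.commute)
      then show ?thesis
        using False by (simp add: h(2)[OF z] norm_mult mult.commute)
    qed
    then show "cmod (h z) \<le> B + e" by (simp add: R_def)
  qed
  with h that show thesis by blast
qed

text \<open>Two divisions by z, each after subtracting the value at 0, which at most doubles the
  bound.\<close>

lemma Taylor_remainder_unit_disc:
  assumes g: "g holomorphic_on ball 0 1" and B: "\<And>z. cmod z < 1 \<Longrightarrow> cmod (g z) \<le> B"
    and z: "cmod z < 1"
  shows "cmod (g z - g 0 - deriv g 0 * z) \<le> 4 * B * (cmod z)\<^sup>2"
proof -
  have 1: "cmod (g z - g 0) \<le> 2 * B" if "cmod z < 1" for z
    using norm_triangle_ineq4[of "g z" "g 0"] B[OF that] B[of 0] by simp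
  obtain h where h: "h holomorphic_on ball 0 1" "\<And>z. cmod z < 1 \<Longrightarrow> g z - g 0 = z * h z"
    "deriv (\<lambda>z. g z - g 0) 0 = h 0" "\<And>z. cmod z < 1 \<Longrightarrow> cmod (h z) \<le> 2 * B"
    by (rule Schwarz_quotient[of "\<lambda>z. g z - g 0" "2 * B"]) (use 1 g in \<open>auto intro!: holomorphic_intros\<close>)
  have dg: "deriv g 0 = h 0"
    using h(3) holomorphic_on_imp_differentiable_at[OF g, of 0] by simp
  have 2: "cmod (h z - h 0) \<le> 4 * B" if "cmod z < 1" for z
    using norm_triangle_ineq4[of "h z" "h 0"] h(4)[OF that] h(4)[of 0] by simp
  obtain k where k: "\<And>z. cmod z < 1 \<Longrightarrow> h z - h 0 = z * k z" "\<And>z. cmod z < 1 \<Longrightarrow> cmod (k z) \<le> 4 * B"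
    by (rule Schwarz_quotient[of "\<lambda>z. h z - h 0" "4 * B"]) (use 2 h in \<open>auto intro!: holomorphic_intros\<close>)
  have "g z - g 0 - deriv g 0 * z = z * (h z - h 0)"
    using h(2)[OF z] dg by (simp add: algebra_simps)
  also have "\<dots> = z\<^sup>2 * k z" using k(1)[OF z] by (simp add: power2_eq_square)
  finally have "cmod (g z - g 0 - deriv g 0 * z) = (cmod z)\<^sup>2 * cmod (k z)"
    by (simp add: norm_mult norm_power)
  also have "\<dots> \<le> (cmod z)\<^sup>2 * (4 * B)"
    using k(2)[OF z] by (intro mult_left_mono) auto
  finally show ?thesis by (simp add: mult.commute)
qed

lemma norm_vector_scalar_mult:
  fixes v :: "complex ^ 'n"
  shows "norm (c *s v) = cmod c * norm v"
  unfolding norm_vec_def by (simp add: norm_mult L2_set_right_distrib)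

lemma tendsto_vector_scalar_mult:
  fixes v :: "'a \<Rightarrow> complex ^ 'n"
  assumes "(c \<longlongrightarrow> c0) F" "(v \<longlongrightarrow> v0) F"
  shows "((\<lambda>x. c x *s v x) \<longlongrightarrow> c0 *s v0) F"
  unfolding vector_scalar_mult_def
  by (intro tendsto_vec_lambda tendsto_mult tendsto_vec_nth assms)

text \<open>Frechet differentiability fixes the base point, whereas here it moves together with the
  step. On complex lines near \<open>z\<close> the Taylor remainder has a bound that is the same for
  all lines, so all quotients can be compared with those at one fixed step \<open>\<xi>0\<close>,
  where continuity of \<open>f\<close> suffices.\<close>

lemma hol_to_disc_strict_derivative:
  fixes u w :: "'a \<Rightarrow> complex ^ 'n"
  assumes f: "f \<in> hol_to_disc D" and r: "0 < r" "ball z r \<subseteq> D"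
    and u: "(u \<longlongrightarrow> z) F" and w: "(w \<longlongrightarrow> w0) F"
    and \<eta>: "(\<eta> \<longlongrightarrow> 0) F" "eventually (\<lambda>x. \<eta> x \<noteq> 0) F"
  shows "((\<lambda>x. (f (u x + \<eta> x *s w x) - f (u x)) / \<eta> x) \<longlongrightarrow> frechet_derivative f (at z) w0) F"
proof (rule tendstoI)
  fix e :: real assume e: "0 < e"
  define R where "R = norm w0 + 1"
  have R: "0 < R" by (simp add: R_def add_nonneg_pos)
  define \<rho> where "\<rho> = r / (2 * R)"
  have \<rho>: "0 < \<rho>" "\<rho> * R = r / 2" using r R by (simp_all add: \<rho>_def)
  define q where "q u w \<xi> = f (u + (of_real \<rho> * \<xi>) *s w)" for u w :: "complex ^ 'n" and \<xi>
  have inD: "u + (of_real \<rho> * \<xi>) *s w \<in> D"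
    if "norm (u - z) < r / 2" "norm w < R" "cmod \<xi> < 1" for u w :: "complex ^ 'n" and \<xi>
  proof -
    have "norm ((of_real \<rho> * \<xi>) *s w) = \<rho> * (cmod \<xi> * norm w)"
      using \<rho> by (simp add: norm_vector_scalar_mult norm_mult)
    also have "\<dots> \<le> \<rho> * (1 * R)"
      using that \<rho> by (intro mult_left_mono mult_mono) auto
    also have "\<dots> = r / 2" using \<rho>(2) by simp
    finally have "norm (u + (of_real \<rho> * \<xi>) *s w - z) < r"
      using that(1) norm_triangle_ineq[of "u - z" "(of_real \<rho> * \<xi>) *s w"]
      by (simp add: algebra_simps)
    then show ?thesis using r(2) by (auto simp: dist_norm norm_minus_commute)
  qed
  have hol: "q u w holomorphic_on ball 0 1"
    if "norm (u - z) < r / 2" "norm w < R" for u w :: "complex ^ 'n"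
    unfolding q_def by (rule hol_to_disc_compose(1)[OF f open_ball])
      (use inD[OF that] in \<open>auto intro!: holomorphic_intros\<close>)
  have Taylor: "cmod ((q u w \<xi> - q u w 0) / \<xi> - deriv (q u w) 0) \<le> 4 * cmod \<xi>"
    if uw: "norm (u - z) < r / 2" "norm w < R" and \<xi>: "\<xi> \<noteq> 0" "cmod \<xi> < 1"
    for u w :: "complex ^ 'n" and \<xi>
  proof -
    have "cmod (q u w \<xi> - q u w 0 - deriv (q u w) 0 * \<xi>) \<le> 4 * 1 * (cmod \<xi>)\<^sup>2"
    proof (rule Taylor_remainder_unit_disc[OF hol[OF uw] _ \<xi>(2)])
      fix x assume "cmod x < 1"
      then show "cmod (q u w x) \<le> 1"
        using hol_to_disc_frechet(3)[OF f inD[OF uw]] unfolding q_def by (simp add: less_imp_le)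
    qed
    moreover have "(q u w \<xi> - q u w 0) / \<xi> - deriv (q u w) 0 =
        (q u w \<xi> - q u w 0 - deriv (q u w) 0 * \<xi>) / \<xi>"
      using \<xi>(1) by (simp add: field_simps)
    ultimately show ?thesis
      using \<xi>(1) by (simp add: norm_divide divide_le_eq power2_eq_square)
  qed
  have z0: "norm (z - z) < r / 2" "norm w0 < R" using r by (simp_all add: R_def)
  have dQ: "deriv (q z w0) 0 = of_real \<rho> * frechet_derivative f (at z) w0"
  proof -
    have "deriv (q z w0) 0 = frechet_derivative f (at (z + (of_real \<rho> * 0) *s w0))
        (disc_deriv (\<lambda>\<xi>. z + (of_real \<rho> * \<xi>) *s w0) 0)"
      unfolding q_def by (rule hol_to_disc_compose(2)[OF f open_ball[of 0 1]])
        (use inD[OF z0] in \<open>auto intro!: holomorphic_intros\<close>)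
    also have "disc_deriv (\<lambda>\<xi>. z + (of_real \<rho> * \<xi>) *s w0) 0 = of_real \<rho> *s w0"
      unfolding disc_deriv_def vec_eq_iff
      by (auto intro!: DERIV_imp_deriv derivative_eq_intros)
    finally show ?thesis
      using hol_to_disc_frechet(2)[OF f subsetD[OF r(2)], of z] r(1) by simp
  qed
  \<comment> \<open>Three Taylor errors of at most \<open>4 * \<delta>\<close> and one continuity
    error below \<open>\<delta>\<close> add up to \<open>13 * \<delta>\<close>.\<close>
  define \<delta> where "\<delta> = min (1 / 2) (e * \<rho> / 14)"
  have \<delta>: "0 < \<delta>" "\<delta> < 1" "13 * \<delta> < e * \<rho>"
    using e \<rho> by (auto simp: \<delta>_def min_def)
  define \<xi>0 where "\<xi>0 = complex_of_real \<delta>"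
  have \<xi>0: "\<xi>0 \<noteq> 0" "cmod \<xi>0 < 1" "cmod \<xi>0 = \<delta>" using \<delta> by (simp_all add: \<xi>0_def)
  have cont: "((\<lambda>x. (q (u x) (w x) \<xi>0 - q (u x) (w x) 0) / \<xi>0) \<longlongrightarrow> (q z w0 \<xi>0 - q z w0 0) / \<xi>0) F"
  proof -
    have "((\<lambda>x. q (u x) (w x) \<xi>) \<longlongrightarrow> q z w0 \<xi>) F" if "cmod \<xi> < 1" for \<xi>
      unfolding q_def
    proof (rule isCont_tendsto_compose[of _ f])
      show "isCont f (z + (of_real \<rho> * \<xi>) *s w0)"
        using hol_to_disc_frechet(1)[OF f inD[OF z0 that]] by (rule has_derivative_continuous)
    qed (intro tendsto_add tendsto_vector_scalar_mult u w tendsto_const)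
    from this[OF \<xi>0(2)] this[of 0] show ?thesis
      using \<xi>0(1) by (intro tendsto_divide tendsto_diff tendsto_const) auto
  qed
  have "eventually (\<lambda>x. dist (w x) w0 < 1) F" "eventually (\<lambda>x. dist (u x) z < r / 2) F"
    "eventually (\<lambda>x. dist (\<eta> x) 0 < \<rho> * \<delta>) F"
    "eventually (\<lambda>x. dist ((q (u x) (w x) \<xi>0 - q (u x) (w x) 0) / \<xi>0) ((q z w0 \<xi>0 - q z w0 0) / \<xi>0) < \<delta>) F"
    using r \<rho>(1) \<delta>(1) by (intro tendstoD[OF w] tendstoD[OF u] tendstoD[OF \<eta>(1)] tendstoD[OF cont]; simp)+
  with \<eta>(2) show "eventually (\<lambda>x. dist ((f (u x + \<eta> x *s w x) - f (u x)) / \<eta> x)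
      (frechet_derivative f (at z) w0) < e) F"
  proof eventually_elim
    case (elim x)
    have ux: "norm (u x - z) < r / 2" using elim by (simp add: dist_norm)
    have wx: "norm (w x) < R"
      using elim norm_triangle_ineq[of "w x - w0" w0] by (simp add: dist_norm R_def)
    define \<xi> where "\<xi> = \<eta> x / of_real \<rho>"
    have \<xi>: "\<xi> \<noteq> 0" "cmod \<xi> < \<delta>" "\<eta> x = of_real \<rho> * \<xi>"
      using elim \<rho> by (simp_all add: \<xi>_def norm_divide divide_less_eq mult.commute)
    define E where "E = (f (u x + \<eta> x *s w x) - f (u x)) / \<eta> x"
    have E: "of_real \<rho> * E = (q (u x) (w x) \<xi> - q (u x) (w x) 0) / \<xi>"
      using \<rho>(1) \<xi>(1) by (simp add: E_def q_def \<xi>(3))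
    have "cmod (of_real \<rho> * E - deriv (q (u x) (w x)) 0) \<le> 4 * \<delta>"
      using Taylor[OF ux wx \<xi>(1)] \<xi>(2) \<delta>(2) unfolding E by simp
    moreover have "cmod ((q (u x) (w x) \<xi>0 - q (u x) (w x) 0) / \<xi>0 - deriv (q (u x) (w x)) 0) \<le> 4 * \<delta>"
      using Taylor[OF ux wx \<xi>0(1,2)] \<xi>0(3) by simp
    moreover have "cmod ((q z w0 \<xi>0 - q z w0 0) / \<xi>0 - of_real \<rho> * frechet_derivative f (at z) w0) \<le> 4 * \<delta>"
      using Taylor[OF z0 \<xi>0(1,2)] \<xi>0(3) dQ by simp
    moreover have "cmod ((q (u x) (w x) \<xi>0 - q (u x) (w x) 0) / \<xi>0 - (q z w0 \<xi>0 - q z w0 0) / \<xi>0) < \<delta>"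
      using elim by (simp add: dist_norm)
    moreover have "cmod (a - c) \<le> cmod (a - b) + cmod (x - b) + cmod (x - y) + cmod (y - c)"
      for a b c x y :: complex by norm
    ultimately have "cmod (of_real \<rho> * E - of_real \<rho> * frechet_derivative f (at z) w0) < 13 * \<delta>"
      by (smt (verit, ccfv_threshold))
    also have "of_real \<rho> * E - of_real \<rho> * frechet_derivative f (at z) w0 =
        of_real \<rho> * (E - frechet_derivative f (at z) w0)" by (simp add: algebra_simps)
    finally have "\<rho> * cmod (E - frechet_derivative f (at z) w0) < 13 * \<delta>"
      using \<rho>(1) by (simp add: norm_mult)
    also have "\<dots> < \<rho> * e" using \<delta>(3) by (simp only: mult.commute)
    finally show ?case using \<rho>(1) by (simp add: E_def dist_norm)
  qed
qed


subsection \<open>The Caratheodory-Reiffen pseudometric\<close>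

lemma vector_3_holomorphic:
  assumes "f holomorphic_on S" "g holomorphic_on S" "h holomorphic_on S"
  shows "(\<lambda>\<zeta>. (vector [f \<zeta>, g \<zeta>, h \<zeta>] :: complex ^ 3) $ i) holomorphic_on S"
  using exhaust_3[of i] assms by auto

lemma tendsto_vector_3:
  assumes "(f \<longlongrightarrow> a) F" "(g \<longlongrightarrow> b) F" "(h \<longlongrightarrow> c) F"
  shows "((\<lambda>x. vector [f x, g x, h x] :: complex ^ 3) \<longlongrightarrow> vector [a, b, c]) F"
proof (rule vec_tendstoI)
  fix i :: 3
  show "((\<lambda>x. (vector [f x, g x, h x] :: complex ^ 3) $ i) \<longlongrightarrow> (vector [a, b, c] :: complex ^ 3) $ i) F"
    using exhaust_3[of i] assms by auto
qed

lemma symmetrized_three_disc_axis_1: "cmod \<xi> < 1 \<Longrightarrow> vector [\<xi>, 0, 0] \<in> symmetrized_three_disc"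
  unfolding symmetrized_three_disc_def mem_Collect_eq
  by (intro exI[of _ \<xi>] exI[of _ 0]) simp

lemma symmetrized_three_disc_axis_2: "cmod \<xi> < 1 \<Longrightarrow> vector [0, \<xi>, 0] \<in> symmetrized_three_disc"
  unfolding symmetrized_three_disc_def mem_Collect_eq
  by (intro exI[of _ "csqrt (- \<xi>)"] exI[of _ "- csqrt (- \<xi>)"] exI[of _ 0])
    (simp add: power2_eq_square[symmetric])

lemma zero_eq_vector_3: "(0 :: complex ^ 3) = vector [0, 0, 0]"
  by (simp add: vec_eq_iff forall_3)

lemma ball_subset_symmetrized_three_disc: "ball 0 (1 / 3) \<subseteq> symmetrized_three_disc"
proof
  fix z :: "complex ^ 3" assume "z \<in> ball 0 (1 / 3)"
  then have "cmod (z $ i) < 1 / 3" for i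
    using Finite_Cartesian_Product.norm_nth_le[of z i] by simp
  then show "z \<in> symmetrized_three_disc" by (intro mem_symmetrized_three_disc)
qed

lemma zero_mem_symmetrized_three_disc: "0 \<in> symmetrized_three_disc"
  by (rule subsetD[OF ball_subset_symmetrized_three_disc]) simp

text \<open>Only the part of weight two of \<open>f\<close> survives in the coefficient of \<open>\<zeta>\<^sup>2\<close> in
  \<open>f (\<zeta> s1, \<zeta>\<^sup>2 s2, \<zeta>\<^sup>3 s3)\<close>.\<close>

lemma weight_two_coefficient:
  assumes f: "f \<in> hol_to_disc symmetrized_three_disc" and f0: "f 0 = 0"
  shows "\<exists>b. \<forall>s1 s2 s3.
    (\<forall>\<zeta>. cmod \<zeta> < 1 \<longrightarrow> vector [\<zeta> * s1, \<zeta>\<^sup>2 * s2, \<zeta> ^ 3 * s3] \<in> symmetrized_three_disc) \<longrightarrow>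
    cmod (frechet_derivative f (at 0) (axis 2 1) * s2 + b * s1\<^sup>2) \<le> 1"
proof -
  \<comment> \<open>The witness will be the coefficient of \<xi>^2 in \<open>p\<close>. It depends
    on \<open>f\<close> alone, so it can later be eliminated between two points.\<close>
  define p where "p \<xi> = f (vector [\<xi>, 0, 0])" for \<xi>
  have "p holomorphic_on ball 0 1"
    unfolding p_def by (rule hol_to_disc_compose(1)[OF f open_ball])
      (auto intro!: vector_3_holomorphic holomorphic_intros symmetrized_three_disc_axis_1)
  moreover have "p 0 = 0" using f0 by (simp add: p_def zero_eq_vector_3)
  ultimately obtain h where h: "h holomorphic_on ball 0 1" "\<And>z. cmod z < 1 \<Longrightarrow> p z = z * h z"
    using Schwarz3[of p 1] by blast
  obtain k where k: "k holomorphic_on ball 0 1" "\<And>z. cmod z < 1 \<Longrightarrow> h z - h 0 = z * k z"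
    using Schwarz3[of "\<lambda>z. h z - h 0" 1, OF holomorphic_on_diff[OF h(1) holomorphic_on_const]] by auto
  have p: "p z = z * h 0 + z\<^sup>2 * k z" if "cmod z < 1" for z
    using h(2)[OF that] k(2)[OF that] by (simp add: algebra_simps power2_eq_square)
  let ?a = "frechet_derivative f (at 0) (axis 2 1)"
  have "cmod (?a * s2 + k 0 * s1\<^sup>2) \<le> 1"
    if s: "\<And>\<zeta>. cmod \<zeta> < 1 \<Longrightarrow> vector [\<zeta> * s1, \<zeta>\<^sup>2 * s2, \<zeta> ^ 3 * s3] \<in> symmetrized_three_disc"
    for s1 s2 s3
  proof -
    define g where "g \<zeta> = f (vector [\<zeta> * s1, \<zeta>\<^sup>2 * s2, \<zeta> ^ 3 * s3])" for \<zeta>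
    have g: "g holomorphic_on ball 0 1"
      unfolding g_def by (rule hol_to_disc_compose(1)[OF f open_ball])
        (auto intro!: vector_3_holomorphic holomorphic_intros s)
    have g0: "g 0 = 0" using f0 by (simp add: g_def zero_eq_vector_3)
    have g1: "cmod (g z) \<le> 1" if "cmod z < 1" for z
      using hol_to_disc_frechet(3)[OF f s[OF that]] by (simp add: g_def)
    obtain m where m: "m holomorphic_on ball 0 1" "\<And>z. cmod z < 1 \<Longrightarrow> g z = z * m z"
      "\<And>z. cmod z < 1 \<Longrightarrow> cmod (m z) \<le> 1"
      by (rule Schwarz_quotient[OF g g0 g1]) (assumption, rule that)
    obtain l where l: "l holomorphic_on ball 0 1" "\<And>z. cmod z < 1 \<Longrightarrow> m z - m 0 = z * l z"
      "deriv (\<lambda>z. m z - m 0) 0 = l 0"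
      using Schwarz3[of "\<lambda>z. m z - m 0" 1, OF holomorphic_on_diff[OF m(1) holomorphic_on_const]] by auto
    have dm: "deriv m 0 = l 0"
      using l(3) holomorphic_on_imp_differentiable_at[OF m(1), of 0] by simp
    have l0: "cmod (l 0) \<le> 1"
    proof (rule field_le_mult_one_interval)
      fix r :: real assume r: "0 < r" "r < 1"
      have "cball 0 r \<subseteq> ball (0 :: complex) 1" using r by auto
      then have "cmod ((deriv ^^ 1) m 0) \<le> fact 1 * 1 / r ^ 1"
        using r m(1,3) by (intro Cauchy_inequality)
          (auto intro: holomorphic_on_subset continuous_on_subset holomorphic_on_imp_continuous_on)
      then show "r * cmod (l 0) \<le> 1" using r by (simp add: dm field_simps)
    qed
    have ev: "eventually (\<lambda>z :: complex. cmod z < 1 \<and> cmod (z * s1) < 1 \<and> z \<noteq> 0) (at 0)"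
    proof -
      have "eventually (\<lambda>z :: complex. dist (z * s1) 0 < 1) (at 0)"
        by (rule tendstoD) (auto intro!: tendsto_eq_intros)
      moreover have "eventually (\<lambda>z :: complex. dist z 0 < 1) (at 0)"
        by (rule tendstoD) (auto intro!: tendsto_eq_intros)
      moreover have "eventually (\<lambda>z :: complex. z \<noteq> 0) (at 0)"
        by (rule eventually_neq_at_within)
      ultimately show ?thesis by eventually_elim auto
    qed
    have contl: "(l \<longlongrightarrow> l 0) (at 0)"
      using holomorphic_on_imp_continuous_on[OF l(1)]
      by (auto simp: continuous_on_eq_continuous_at isCont_def)
    have "isCont k 0"
      using holomorphic_on_imp_continuous_on[OF k(1)] by (auto simp: continuous_on_eq_continuous_at)
    then have contk: "((\<lambda>z. k (z * s1)) \<longlongrightarrow> k 0) (at 0)"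
      by (rule isCont_tendsto_compose) (auto intro!: tendsto_eq_intros)
    \<comment> \<open>The point on the curve is reached from the z1 axis by a step of size z^2, so
      the base point varies with z and the strict form of the derivative is required.\<close>
    have "((\<lambda>z. (f (vector [z * s1, 0, 0] + z\<^sup>2 *s vector [0, s2, z * s3]) - f (vector [z * s1, 0, 0])) / z\<^sup>2)
        \<longlongrightarrow> frechet_derivative f (at 0) (vector [0, s2, 0])) (at 0)"
    proof (rule hol_to_disc_strict_derivative[OF f _ ball_subset_symmetrized_three_disc])
      show "((\<lambda>z. vector [z * s1, 0, 0]) \<longlongrightarrow> (0 :: complex ^ 3)) (at 0)"
        unfolding zero_eq_vector_3
        by (intro tendsto_vector_3 tendsto_const tendsto_mult_left_zero tendsto_ident_at)
      show "((\<lambda>z. vector [0, s2, z * s3]) \<longlongrightarrow> (vector [0, s2, 0] :: complex ^ 3)) (at 0)"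
        by (intro tendsto_vector_3 tendsto_const tendsto_mult_left_zero tendsto_ident_at)
      show "((\<lambda>z :: complex. z\<^sup>2) \<longlongrightarrow> 0) (at 0)" by (auto intro!: tendsto_eq_intros)
      show "eventually (\<lambda>z :: complex. z\<^sup>2 \<noteq> 0) (at 0)"
        using eventually_neq_at_within[of 0 0 UNIV] by simp
    qed simp
    also have "(\<lambda>z. vector [z * s1, 0, 0] + z\<^sup>2 *s vector [0, s2, z * s3]) =
        (\<lambda>z. vector [z * s1, z\<^sup>2 * s2, z ^ 3 * s3] :: complex ^ 3)"
      by (simp add: vec_eq_iff forall_3 power2_eq_square power3_eq_cube fun_eq_iff)
    also have "frechet_derivative f (at 0) (vector [0, s2, 0]) = ?a * s2"
    proof -
      have "vector [0, s2, 0] = s2 *s (axis 2 1 :: complex ^ 3)"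
        by (simp add: vec_eq_iff forall_3 axis_def)
      then show ?thesis
        using hol_to_disc_frechet(2)[OF f zero_mem_symmetrized_three_disc]
        by (simp add: mult.commute)
    qed
    finally have lim: "((\<lambda>z. (g z - p (z * s1)) / z\<^sup>2) \<longlongrightarrow> ?a * s2) (at 0)"
      by (simp add: g_def p_def)
    have expand: "eventually (\<lambda>z. (g z - p (z * s1)) / z\<^sup>2 = (m 0 - s1 * h 0) / z + (l z - s1\<^sup>2 * k (z * s1))) (at 0)"
      using ev
    proof eventually_elim
      case (elim z)
      have "g z = z * m 0 + z\<^sup>2 * l z"
        using elim m(2)[of z] l(2)[of z] by (simp add: algebra_simps power2_eq_square)
      then show ?case
        using elim p[of "z * s1"] by (simp add: field_simps power2_eq_square)
    qed
    have lim': "((\<lambda>z. (m 0 - s1 * h 0) / z + (l z - s1\<^sup>2 * k (z * s1))) \<longlongrightarrow> ?a * s2) (at 0)"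
      using lim expand by (rule Lim_transform_eventually)
    \<comment> \<open>Multiplying by z isolates the coefficient of 1 / z, which must vanish because
      the quotient converges.\<close>
    have "((\<lambda>z. z * ((m 0 - s1 * h 0) / z + (l z - s1\<^sup>2 * k (z * s1)))
        - z * (l z - s1\<^sup>2 * k (z * s1))) \<longlongrightarrow> 0 * (?a * s2) - 0 * (l 0 - s1\<^sup>2 * k 0)) (at 0)"
      by (intro tendsto_diff tendsto_mult tendsto_const contk contl tendsto_ident_at lim')
    moreover have "eventually (\<lambda>z. z * ((m 0 - s1 * h 0) / z + (l z - s1\<^sup>2 * k (z * s1)))
        - z * (l z - s1\<^sup>2 * k (z * s1)) = m 0 - s1 * h 0) (at 0)"
      using ev by eventually_elim (simp add: field_simps)
    ultimately have "((\<lambda>z :: complex. m 0 - s1 * h 0) \<longlongrightarrow> 0) (at 0)"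
      by (simp add: Lim_transform_eventually)
    then have "m 0 - s1 * h 0 = 0" by (simp add: tendsto_const_iff)
    with lim' have "((\<lambda>z. l z - s1\<^sup>2 * k (z * s1)) \<longlongrightarrow> ?a * s2) (at 0)" by simp
    moreover have "((\<lambda>z. l z - s1\<^sup>2 * k (z * s1)) \<longlongrightarrow> l 0 - s1\<^sup>2 * k 0) (at 0)"
      by (intro tendsto_diff tendsto_mult tendsto_const contk contl)
    ultimately have "?a * s2 = l 0 - s1\<^sup>2 * k 0"
      by (rule tendsto_unique[rotated]) simp
    then show ?thesis using l0 by (simp add: mult.commute)
  qed
  then show ?thesis by (intro exI[of _ "k 0"] allI impI) blast
qed


text \<open>For the \<open>b\<close> minimizing the maximum of \<open>|z2 + b z1\<^sup>2|\<close> over the torus, the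
  maximum is nearly attained at the points with \<open>(t1, t2, t3) = (1, 1, v)\<close> and
  \<open>(1, 1, w)\<close>, where \<open>v, w = (-45 + 28 \<i>) / 53, (-45 - 28 \<i>) / 53\<close>.\<close>

lemma frechet_derivative_symmetrized_three_disc:
  assumes f: "f \<in> hol_to_disc symmetrized_three_disc" and f0: "f 0 = 0"
  shows "cmod (frechet_derivative f (at 0) (axis 2 1)) \<le> 4505 / 5488"
proof -
  define a where "a = frechet_derivative f (at 0) (axis 2 1)"
  obtain b where b: "\<forall>s1 s2 s3.
      (\<forall>\<zeta>. cmod \<zeta> < 1 \<longrightarrow> vector [\<zeta> * s1, \<zeta>\<^sup>2 * s2, \<zeta> ^ 3 * s3] \<in> symmetrized_three_disc) \<longrightarrow>
      cmod (a * s2 + b * s1\<^sup>2) \<le> 1"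
    using weight_two_coefficient[OF f f0] unfolding a_def ..
  have *: "cmod (a * (1 + 2 * v) + b * (2 + v)\<^sup>2) \<le> 1" if v: "cmod v = 1" for v
  proof (rule b[rule_format])
    fix \<zeta> :: complex assume "cmod \<zeta> < 1"
    then show "vector [\<zeta> * (2 + v), \<zeta>\<^sup>2 * (1 + 2 * v), \<zeta> ^ 3 * v] \<in> symmetrized_three_disc"
      unfolding symmetrized_three_disc_def mem_Collect_eq using v
      by (intro exI[of _ \<zeta>] exI[of _ "\<zeta> * v"])
        (simp add: norm_mult vec_eq_iff forall_3 algebra_simps power2_eq_square power3_eq_cube)
  qed
  \<comment> \<open>For v = e^(i \<theta>) and w = cnj v the argument yields the bound (5 + 4 cos
    \<theta>) / (2 sin \<theta> (1 - cos \<theta>)), minimal near cos \<theta> = -0.85. As 28^2 +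
    45^2 = 53^2, a rational point of the circle lies close to that.\<close>
  define v where "v = Complex (- 45 / 53) (28 / 53)"
  define w where "w = Complex (- 45 / 53) (- 28 / 53)"
  have sq: "(cmod (2 + v))\<^sup>2 = 85 / 53" "(cmod (2 + w))\<^sup>2 = 85 / 53"
    unfolding cmod_power2 by (simp_all add: v_def w_def power2_eq_square)
  have vw: "cmod v = 1" "cmod w = 1"
    "(1 + 2 * v) * (2 + w)\<^sup>2 - (1 + 2 * w) * (2 + v)\<^sup>2 = Complex 0 (4 * 28 * 98 / 53\<^sup>2)"
    by (simp_all add: v_def w_def complex_norm power2_eq_square complex_eq_iff)
  \<comment> \<open>Cross-multiplication eliminates the unknown \<open>b\<close>.\<close>
  have "a * Complex 0 (4 * 28 * 98 / 53\<^sup>2) = (a * (1 + 2 * v) + b * (2 + v)\<^sup>2) * (2 + w)\<^sup>2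
      - (a * (1 + 2 * w) + b * (2 + w)\<^sup>2) * (2 + v)\<^sup>2"
    unfolding vw(3)[symmetric] by (simp add: algebra_simps)
  then have "cmod a * (4 * 28 * 98 / 53\<^sup>2) = cmod ((a * (1 + 2 * v) + b * (2 + v)\<^sup>2) * (2 + w)\<^sup>2
      - (a * (1 + 2 * w) + b * (2 + w)\<^sup>2) * (2 + v)\<^sup>2)"
    by (metis (no_types) norm_mult cmod_eq_Im abs_of_nonneg complex.sel zero_le_divide_iff zero_le_power2 zero_le_numeral mult_nonneg_nonneg)
  also have "\<dots> \<le> 1 * (85 / 53) + 1 * (85 / 53)"
    using mult_right_mono[OF *[OF vw(1)], of "85 / 53"] mult_right_mono[OF *[OF vw(2)], of "85 / 53"]
    by (intro order_trans[OF norm_triangle_ineq4 add_mono]) (simp_all only: norm_mult norm_power sq)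
  finally show ?thesis by (simp add: a_def field_simps)
qed

subsection \<open>The pseudonorm below the second Reiffen and the Kobayashi-Royden pseudometrics\<close>

lemma quartic_has_derivative:
  fixes z :: "complex ^ 3"
  shows "((\<lambda>z. quartic (z $ 1) (z $ 2)) has_derivative
    (\<lambda>v. (1350 * z $ 2 * v $ 2 - 291 * (2 * z $ 1 * v $ 1 * z $ 2 + (z $ 1)\<^sup>2 * v $ 2)
      + 132 * (z $ 1) ^ 3 * v $ 1) / 1000)) (at z)"
  unfolding quartic_def
  by ((rule derivative_eq_intros bounded_linear_imp_has_derivative bounded_linear_vec_nth refl)+,
    simp, rule ext, simp add: power2_eq_square power3_eq_cube algebra_simps add_divide_distrib diff_divide_distrib)

lemma quartic_hol_to_disc: "(\<lambda>z. quartic (z $ 1) (z $ 2)) \<in> hol_to_disc symmetrized_three_disc"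
  unfolding hol_to_disc_def mem_Collect_eq
proof (intro conjI ballI)
  fix z :: "complex ^ 3"
  show "\<exists>f'. ((\<lambda>z. quartic (z $ 1) (z $ 2)) has_derivative f') (at z) \<and> (\<forall>c v. f' (c *s v) = c * f' v)"
    by (rule exI, rule conjI, rule quartic_has_derivative) (simp add: algebra_simps)
  show "(\<lambda>z. quartic (z $ 1) (z $ 2)) ` symmetrized_three_disc \<subseteq> unit_disc"
    using quartic_symmetrized_three_disc by fastforce
qed

lemma deriv_cubic_quartic:
  fixes A B C :: complex
  shows "deriv (\<lambda>t. A * t\<^sup>2 + B * t ^ 3 + C * t ^ 4) = (\<lambda>t. 2 * A * t + 3 * B * t\<^sup>2 + 4 * C * t ^ 3)"
    and "deriv (\<lambda>t. 2 * A * t + 3 * B * t\<^sup>2 + 4 * C * t ^ 3) 0 = 2 * A"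
  by (rule ext, rule DERIV_imp_deriv, (rule derivative_eq_intros refl)+, simp add: algebra_simps)
    (rule DERIV_imp_deriv, (rule derivative_eq_intros refl)+, simp)

lemma quartic_dir_deriv:
  fixes X :: "complex ^ 3"
  defines "f \<equiv> \<lambda>z :: complex ^ 3. quartic (z $ 1) (z $ 2)"
  shows "dir_deriv 0 f 0 X = 0" "dir_deriv 1 f 0 X = 0" "dir_deriv 2 f 0 X = 27 / 20 * (X $ 2)\<^sup>2"
proof -
  define A where "A = 27 / 40 * (X $ 2)\<^sup>2"
  have eq: "(\<lambda>t. f (0 + t *s X)) =
      (\<lambda>t. A * t\<^sup>2 + (- 291 / 1000 * ((X $ 1)\<^sup>2 * X $ 2)) * t ^ 3 + (33 / 1000 * (X $ 1) ^ 4) * t ^ 4)"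
    by (simp add: f_def A_def quartic_def fun_eq_iff power_mult_distrib field_simps power2_eq_square power3_eq_cube)
  show "dir_deriv 0 f 0 X = 0" "dir_deriv 1 f 0 X = 0"
    unfolding dir_deriv_def eq One_nat_def funpow.simps o_apply id_apply deriv_cubic_quartic
    by simp_all
  have "(deriv ^^ 2) F = deriv (deriv F)" for F :: "complex \<Rightarrow> complex"
    by (simp add: numeral_2_eq_2)
  then have "dir_deriv 2 f 0 X = 2 * A"
    unfolding dir_deriv_def eq by (simp only: deriv_cubic_quartic)
  then show "dir_deriv 2 f 0 X = 27 / 20 * (X $ 2)\<^sup>2" by (simp add: A_def)
qed

lemma pseudonorm_component:
  assumes "0 \<le> c"
  shows "pseudonorm (\<lambda>X. ennreal (c * cmod (X $ i)))"
  unfolding pseudonorm_def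
proof (intro conjI allI)
  fix a X
  show "ennreal (c * cmod ((a *s X) $ i)) = ennreal (cmod a) * ennreal (c * cmod (X $ i))"
    using assms by (simp add: norm_mult ennreal_mult'[symmetric] mult.left_commute)
next
  fix X Y
  have "c * cmod ((X + Y) $ i) \<le> c * cmod (X $ i) + c * cmod (Y $ i)"
    using mult_left_mono[OF norm_triangle_ineq assms] by (simp add: distrib_left)
  then show "ennreal (c * cmod ((X + Y) $ i)) \<le> ennreal (c * cmod (X $ i)) + ennreal (c * cmod (Y $ i))"
    using assms by (simp flip: ennreal_plus)
qed

lemma le_largest_pseudonorm:
  assumes "pseudonorm N" "\<And>X. N X \<le> p X"
  shows "N X \<le> largest_pseudonorm p X"
  unfolding largest_pseudonorm_eq_SUP by (rule SUP_upper) (use assms in auto)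

text \<open>In \<open>quartic\<close> the monomials other than z2^2 have ordinary degrees 3 and 4,
  so they do not enter the second derivative at 0.\<close>

lemma component_le_reiffen:
  "ennreal (sqrt (27 / 40) * cmod (X $ 2)) \<le> reiffen 2 symmetrized_three_disc 0 X"
  unfolding reiffen_def
proof (rule Sup_upper, unfold mem_Collect_eq, intro exI conjI)
  let ?f = "\<lambda>z :: complex ^ 3. quartic (z $ 1) (z $ 2)"
  show "?f \<in> hol_to_disc symmetrized_three_disc" by (rule quartic_hol_to_disc)
  show "enat 2 \<le> vanishing_order ?f 0"
    unfolding vanishing_order_def
  proof (rule Inf_greatest)
    fix n assume "n \<in> enat ` {j. \<exists>X. dir_deriv j ?f 0 X \<noteq> 0}"
    then obtain j X where j: "n = enat j" "dir_deriv j ?f 0 X \<noteq> 0" by auto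
    then have "j \<noteq> 0" "j \<noteq> 1" using quartic_dir_deriv[of X] by metis+
    then show "enat 2 \<le> n" using j(1) by simp
  qed
  show "ennreal (sqrt (27 / 40) * cmod (X $ 2)) = ennreal (root 2 (cmod (dir_deriv 2 ?f 0 X / fact 2)))"
    unfolding quartic_dir_deriv(3)
    by (simp add: norm_mult norm_power norm_divide real_sqrt_mult real_sqrt_divide sqrt_def[symmetric])
qed

section \<open>Analytic discs in the symmetrized three-disc\<close>

lemma hol_bound_of_id_mult:
  assumes H: "H holomorphic_on ball 0 1" and M: "\<And>z. cmod z < 1 \<Longrightarrow> cmod (z * H z) \<le> M"
    and z: "cmod z < 1"
  shows "cmod (H z) \<le> M"
proof -
  have g: "(\<lambda>z. z * H z) holomorphic_on ball 0 1" by (intro holomorphic_intros H)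
  obtain h where h: "h holomorphic_on ball 0 1" "\<And>z. cmod z < 1 \<Longrightarrow> z * H z = z * h z"
    "deriv (\<lambda>z. z * H z) 0 = h 0" "\<And>z. cmod z < 1 \<Longrightarrow> cmod (h z) \<le> M"
    by (rule Schwarz_quotient[of "\<lambda>z. z * H z", OF g mult_zero_left M]) (assumption, rule that)
  \<comment> \<open>At 0 the equation \<open>z * H z = z * h z\<close> says nothing, so the values
    there are compared through the derivative of the product.\<close>
  have "((\<lambda>z. z * H z) has_field_derivative 1 * H 0 + deriv H 0 * 0) (at 0)"
    by (intro DERIV_mult DERIV_ident holomorphic_derivI[OF H]) auto
  then have "h 0 = H 0" using h(3) DERIV_imp_deriv by fastforce
  then have "h z = H z" using h(2)[OF z] by (cases "z = 0") auto
  then show ?thesis using h(4)[OF z] by simp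
qed

text \<open>Every difference of monomials splits into terms with a factor \<open>x' - x\<close> or
  \<open>y' - y\<close>. The cofactor bounds give the constant 37.773, rounded up. The radius 6 fits
  differences of two points of the domain.\<close>

lemma quartic_Lipschitz:
  assumes "cmod x \<le> 3" "cmod y \<le> 3" "cmod x' \<le> 6" "cmod y' \<le> 6"
    and "cmod (x' - x) \<le> e" "cmod (y' - y) \<le> e"
  shows "cmod (quartic x' y') \<le> cmod (quartic x y) + 40 * e"
proof -
  have e: "0 \<le> e" using assms(5) norm_ge_zero order_trans by blast
  have sum: "cmod (x' + x) \<le> 9" "cmod (y' + y) \<le> 9" "cmod (x'\<^sup>2 + x\<^sup>2) \<le> 45"
  proof -
    show "cmod (x' + x) \<le> 9" "cmod (y' + y) \<le> 9"
      using norm_triangle_ineq[of x' x] norm_triangle_ineq[of y' y] assms by linarith+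
    have "cmod (x'\<^sup>2 + x\<^sup>2) \<le> cmod x' ^ 2 + cmod x ^ 2"
      using norm_triangle_ineq[of "x'\<^sup>2" "x\<^sup>2"] by (simp add: norm_power)
    also have "\<dots> \<le> 6\<^sup>2 + 3\<^sup>2" using assms by (intro add_mono power_mono) auto
    finally show "cmod (x'\<^sup>2 + x\<^sup>2) \<le> 45" by simp
  qed
  define p q r s where "p = (y' - y) * (y' + y)" and "q = x\<^sup>2 * (y' - y)"
    and "r = (x' - x) * (x' + x) * y'" and "s = (x' - x) * (x' + x) * (x'\<^sup>2 + x\<^sup>2)"
  have "cmod p \<le> e * 9" "cmod q \<le> 3\<^sup>2 * e" "cmod r \<le> e * 9 * 6" "cmod s \<le> e * 9 * 45"
    unfolding p_def q_def r_def s_def norm_mult norm_power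
    using assms sum e by (intro mult_mono power_mono mult_nonneg_nonneg; simp)+
  moreover have "1000 * (quartic x' y' - quartic x y) = 675 * p - 291 * q - 291 * r + 33 * s"
  proof -
    have q: "1000 * quartic x y = 675 * y\<^sup>2 - 291 * (x\<^sup>2 * y) + 33 * x ^ 4" for x y
      by (simp add: quartic_def)
    show ?thesis
      unfolding p_def q_def r_def s_def using q[of x y] q[of x' y'] by algebra
  qed
  then have "1000 * cmod (quartic x' y' - quartic x y) = cmod (675 * p - 291 * q - 291 * r + 33 * s)"
    by (metis norm_mult norm_numeral)
  moreover have "cmod (675 * p - 291 * q - 291 * r + 33 * s) \<le> 675 * cmod p + 291 * cmod q + 291 * cmod r + 33 * cmod s"
    using norm_triangle_ineq[of "675 * p - 291 * q - 291 * r" "33 * s"]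
      norm_triangle_ineq4[of "675 * p - 291 * q" "291 * r"] norm_triangle_ineq4[of "675 * p" "291 * q"]
    by (simp add: norm_mult)
  ultimately have "1000 * cmod (quartic x' y' - quartic x y) \<le> 40000 * e" using e by simp
  then show ?thesis using norm_triangle_ineq2[of "quartic x' y'" "quartic x y"] by linarith
qed

lemma hol_discs_symmetrized_three_disc:
  assumes "\<phi> \<in> hol_discs symmetrized_three_disc"
  shows "(\<lambda>\<zeta>. \<phi> \<zeta> $ i) holomorphic_on ball 0 1"
    and "cmod \<zeta> < 1 \<Longrightarrow> \<phi> \<zeta> \<in> symmetrized_three_disc"
    and "cmod \<zeta> < 1 \<Longrightarrow> i = 1 \<or> i = 2 \<Longrightarrow> cmod (\<phi> \<zeta> $ i - \<phi> 0 $ i) \<le> 6"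
proof -
  show "(\<lambda>\<zeta>. \<phi> \<zeta> $ i) holomorphic_on ball 0 1" using assms by (simp add: hol_discs_def)
  have D: "\<phi> \<zeta> \<in> symmetrized_three_disc" if "cmod \<zeta> < 1" for \<zeta>
    using assms that by (auto simp: hol_discs_def)
  then show "cmod \<zeta> < 1 \<Longrightarrow> \<phi> \<zeta> \<in> symmetrized_three_disc" .
  show "cmod (\<phi> \<zeta> $ i - \<phi> 0 $ i) \<le> 6" if "cmod \<zeta> < 1" "i = 1 \<or> i = 2"
    using norm_triangle_ineq4[of "\<phi> \<zeta> $ i" "\<phi> 0 $ i"] that(2)
      symmetrized_three_disc_bound[OF D[OF that(1)]] symmetrized_three_disc_bound[OF D[of 0]] by auto
qed

lemma hol_discs_difference_quotient:
  assumes \<phi>: "\<phi> \<in> hol_discs symmetrized_three_disc" and i: "i = 1 \<or> i = 2"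
  shows "\<exists>h. h holomorphic_on ball 0 1 \<and> deriv (\<lambda>\<zeta>. \<phi> \<zeta> $ i) 0 = h 0 \<and>
    (\<forall>\<zeta>. cmod \<zeta> < 1 \<longrightarrow> \<phi> \<zeta> $ i - \<phi> 0 $ i = \<zeta> * h \<zeta> \<and> cmod (h \<zeta>) \<le> 6)"
proof -
  have g: "(\<lambda>\<zeta>. \<phi> \<zeta> $ i - \<phi> 0 $ i) holomorphic_on ball 0 1" by (intro holomorphic_intros hol_discs_symmetrized_three_disc(1)[OF \<phi>])
  obtain h where h: "h holomorphic_on ball 0 1" "\<And>z. cmod z < 1 \<Longrightarrow> \<phi> z $ i - \<phi> 0 $ i = z * h z"
    "deriv (\<lambda>\<zeta>. \<phi> \<zeta> $ i - \<phi> 0 $ i) 0 = h 0" "\<And>z. cmod z < 1 \<Longrightarrow> cmod (h z) \<le> 6"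
    by (rule Schwarz_quotient[of "\<lambda>\<zeta>. \<phi> \<zeta> $ i - \<phi> 0 $ i", OF g diff_self hol_discs_symmetrized_three_disc(3)[OF \<phi> _ i]])
      (assumption, rule that)
  have "deriv (\<lambda>\<zeta>. \<phi> \<zeta> $ i) 0 = h 0"
    using h(3) holomorphic_on_imp_differentiable_at[OF hol_discs_symmetrized_three_disc(1)[OF \<phi>], of 0] by simp
  with h(1,2,4) show ?thesis by blast
qed

text \<open>The polynomial is applied to \<open>\<phi> - \<phi> 0\<close>, where it equals \<open>\<zeta>\<^sup>2 G \<zeta>\<close> with
  \<open>G \<zeta>\<close> close to \<open>27/40 (h \<zeta>)\<^sup>2\<close>.\<close>

lemma hol_discs_estimate:
  assumes \<phi>: "\<phi> \<in> hol_discs symmetrized_three_disc"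
    and e: "cmod (\<phi> 0 $ 1) \<le> e" "cmod (\<phi> 0 $ 2) \<le> e"
  shows "\<exists>h. deriv (\<lambda>\<zeta>. \<phi> \<zeta> $ 2) 0 = h 0 \<and> (\<forall>\<zeta>. cmod \<zeta> < 1 \<longrightarrow>
    \<phi> \<zeta> $ 2 - \<phi> 0 $ 2 = \<zeta> * h \<zeta> \<and> 27 / 40 * (cmod (h \<zeta>))\<^sup>2 \<le> 1 + 40 * e + 110 * cmod \<zeta>)"
proof -
  note D = hol_discs_symmetrized_three_disc(2)[OF \<phi>]
  note bnd = symmetrized_three_disc_bound[OF D]
  note b = hol_discs_symmetrized_three_disc(3)[OF \<phi>]
  obtain h1 h2 where h1: "h1 holomorphic_on ball 0 1"
      "\<And>\<zeta>. cmod \<zeta> < 1 \<Longrightarrow> \<phi> \<zeta> $ 1 - \<phi> 0 $ 1 = \<zeta> * h1 \<zeta>" "\<And>\<zeta>. cmod \<zeta> < 1 \<Longrightarrow> cmod (h1 \<zeta>) \<le> 6"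
    and h2: "h2 holomorphic_on ball 0 1" "deriv (\<lambda>\<zeta>. \<phi> \<zeta> $ 2) 0 = h2 0"
      "\<And>\<zeta>. cmod \<zeta> < 1 \<Longrightarrow> \<phi> \<zeta> $ 2 - \<phi> 0 $ 2 = \<zeta> * h2 \<zeta>" "\<And>\<zeta>. cmod \<zeta> < 1 \<Longrightarrow> cmod (h2 \<zeta>) \<le> 6"
    using hol_discs_difference_quotient[OF \<phi>, of 1] hol_discs_difference_quotient[OF \<phi>, of 2] by metis
  define p where "p \<zeta> = (33 * \<zeta> * h1 \<zeta> ^ 4 - 291 * ((h1 \<zeta>)\<^sup>2 * h2 \<zeta>)) / 1000" for \<zeta>
  define G where "G \<zeta> = 27 / 40 * (h2 \<zeta>)\<^sup>2 + \<zeta> * p \<zeta>" for \<zeta>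
  have G: "G holomorphic_on ball 0 1"
    unfolding G_def p_def by (intro holomorphic_intros h1(1) h2(1)) simp_all
  have "cmod (\<zeta> * (\<zeta> * G \<zeta>)) \<le> 1 + 40 * e" if \<zeta>: "cmod \<zeta> < 1" for \<zeta>
  proof -
    have "\<zeta> * (\<zeta> * G \<zeta>) = quartic (\<zeta> * h1 \<zeta>) (\<zeta> * h2 \<zeta>)"
      by (simp add: G_def p_def quartic_def field_simps eval_nat_numeral)
    also have "\<dots> = quartic (\<phi> \<zeta> $ 1 - \<phi> 0 $ 1) (\<phi> \<zeta> $ 2 - \<phi> 0 $ 2)"
      by (simp add: h1(2)[OF \<zeta>] h2(3)[OF \<zeta>])
    finally have "cmod (\<zeta> * (\<zeta> * G \<zeta>)) \<le> cmod (quartic (\<phi> \<zeta> $ 1) (\<phi> \<zeta> $ 2)) + 40 * e"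
      using quartic_Lipschitz[OF bnd[OF \<zeta>] b[OF \<zeta>, of 1] b[OF \<zeta>, of 2], of e] e by simp
    then show ?thesis using quartic_symmetrized_three_disc[OF D[OF \<zeta>]] by simp
  qed
  \<comment> \<open>Both factors of the double zero are removed without loss in the bound, as in the
    Schwarz lemma for a zero of order two.\<close>
  then have "cmod (\<zeta> * G \<zeta>) \<le> 1 + 40 * e" if "cmod \<zeta> < 1" for \<zeta>
    using that by (intro hol_bound_of_id_mult[where H = "\<lambda>\<zeta>. \<zeta> * G \<zeta>"] holomorphic_intros G)
  then have G_le: "cmod (G \<zeta>) \<le> 1 + 40 * e" if "cmod \<zeta> < 1" for \<zeta>
    using that by (intro hol_bound_of_id_mult[where H = G] G)
  have "27 / 40 * (cmod (h2 \<zeta>))\<^sup>2 \<le> 1 + 40 * e + 110 * cmod \<zeta>" if \<zeta>: "cmod \<zeta> < 1" for \<zeta>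
  proof -
    have "cmod (33 * \<zeta> * h1 \<zeta> ^ 4) \<le> 33 * 1 * 6 ^ 4" "cmod (291 * ((h1 \<zeta>)\<^sup>2 * h2 \<zeta>)) \<le> 291 * (6\<^sup>2 * 6)"
      unfolding norm_mult norm_power norm_numeral
      using \<zeta> h1(3)[OF \<zeta>] h2(4)[OF \<zeta>]
      by (intro mult_mono power_mono mult_nonneg_nonneg zero_le_power; simp)+
    \<comment> \<open>Here 33 * 6^4 + 291 * 6^3 = 105624.\<close>
    then have "cmod (p \<zeta>) \<le> 110"
      using norm_triangle_ineq4[of "33 * \<zeta> * h1 \<zeta> ^ 4" "291 * ((h1 \<zeta>)\<^sup>2 * h2 \<zeta>)"]
      by (simp add: p_def norm_divide)
    then have "cmod (\<zeta> * p \<zeta>) \<le> cmod \<zeta> * 110" unfolding norm_mult by (intro mult_left_mono) auto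
    moreover have "27 / 40 * (cmod (h2 \<zeta>))\<^sup>2 = cmod (G \<zeta> - \<zeta> * p \<zeta>)"
      by (simp add: G_def norm_mult norm_divide norm_power)
    ultimately show ?thesis
      using norm_triangle_ineq4[of "G \<zeta>" "\<zeta> * p \<zeta>"] G_le[OF \<zeta>] by simp
  qed
  with h2(2,3) show ?thesis by blast
qed

text \<open>At the centre of a disc through 0 both error terms of \<open>hol_discs_estimate\<close>
  vanish and the sharp Schwarz bound remains.\<close>

lemma component_le_kobayashi_royden:
  "ennreal (sqrt (27 / 40) * cmod (X $ 2)) \<le> kobayashi_royden symmetrized_three_disc 0 X"
  unfolding kobayashi_royden_def
proof (rule Inf_greatest)
  fix y assume "y \<in> {ennreal \<alpha> |\<alpha>. 0 \<le> \<alpha> \<and> (\<exists>\<phi>\<in>hol_discs symmetrized_three_disc.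
      \<phi> 0 = 0 \<and> \<alpha> *\<^sub>R disc_deriv \<phi> 0 = X)}"
  then obtain \<alpha> \<phi> where y: "y = ennreal \<alpha>" and \<alpha>: "0 \<le> \<alpha>"
    and \<phi>: "\<phi> \<in> hol_discs symmetrized_three_disc" "\<phi> 0 = 0" and X: "\<alpha> *\<^sub>R disc_deriv \<phi> 0 = X" by blast
  define d where "d = cmod (deriv (\<lambda>\<zeta>. \<phi> \<zeta> $ 2) 0)"
  obtain h where "deriv (\<lambda>\<zeta>. \<phi> \<zeta> $ 2) 0 = h 0" "\<forall>\<zeta>. cmod \<zeta> < 1 \<longrightarrow>
      27 / 40 * (cmod (h \<zeta>))\<^sup>2 \<le> 1 + 40 * 0 + 110 * cmod \<zeta>"
    using hol_discs_estimate[OF \<phi>(1), of 0] unfolding \<phi>(2) by auto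
  from this(1) spec[OF this(2), of 0] have "27 / 40 * d\<^sup>2 \<le> 1" by (simp add: d_def)
  then have "(sqrt (27 / 40) * d)\<^sup>2 \<le> 1\<^sup>2" unfolding power_mult_distrib by simp
  then have "sqrt (27 / 40) * d \<le> 1" by (rule power2_le_imp_le) simp
  then have "\<alpha> * (sqrt (27 / 40) * d) \<le> \<alpha> * 1" using \<alpha> by (rule mult_left_mono)
  moreover have "cmod (X $ 2) = \<alpha> * d"
    using \<alpha> by (simp add: X[symmetric] disc_deriv_def d_def)
  ultimately show "ennreal (sqrt (27 / 40) * cmod (X $ 2)) \<le> y"
    unfolding y by (intro ennreal_leI) (simp add: mult.left_commute)
qed

lemma le_artanh:
  assumes "0 \<le> x" "x < (1 :: real)"
  shows "x \<le> artanh x"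
proof -
  have "artanh 0 - 0 \<le> artanh x - x"
  proof (rule DERIV_nonneg_imp_nondecreasing[OF assms(1)])
    fix y assume "0 \<le> y" "y \<le> x"
    then have y: "\<bar>y\<bar> < 1" "y\<^sup>2 < 1" using assms by (simp_all add: abs_square_less_1)
    then have "((\<lambda>x. artanh x - x) has_real_derivative 1 / (1 - y\<^sup>2) - 1) (at y)"
      by (auto intro!: derivative_eq_intros)
    moreover have "0 \<le> 1 / (1 - y\<^sup>2) - 1" using y by (simp add: field_simps)
    ultimately show "\<exists>d. ((\<lambda>x. artanh x - x) has_real_derivative d) (at y) \<and> 0 \<le> d" by blast
  qed
  then show ?thesis by simp
qed

lemma artanh_le:
  assumes "0 \<le> x" "x < (1 :: real)"
  shows "artanh x \<le> x / (1 - x)"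
proof -
  have "artanh x \<le> ((1 + x) / (1 - x) - 1) / 2"
    unfolding artanh_def using ln_le_minus_one[of "(1 + x) / (1 - x)"] assms by simp
  also have "\<dots> = x / (1 - x)" using assms by (simp add: field_simps)
  finally show ?thesis .
qed

subsection \<open>The Kobayashi and the Caratheodory distances\<close>

text \<open>A tent at \<open>t e\<^sub>2\<close> whose slope in the direction \<open>e\<^sub>2\<close> exceeds the bound
  \<open>4505/5488\<close> on the Caratheodory-Reiffen metric but not \<open>sqrt (27/40)\<close>; its
  support shrinks to \<open>0\<close> with \<open>t\<close>, so it is a contraction for the Lempert function.\<close>

definition tent :: "real \<Rightarrow> complex ^ 3 \<Rightarrow> real" where
  "tent t z = max 0 (821 / 1000 * t - max (821 / 1000 * cmod (z $ 2 - of_real t)) (cmod (z $ 1) / 6))"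

text \<open>The tent has height \<open>821 / 1000 * t\<close>, so a drop exceeding |\<alpha>| needs
  a centre in its support and |\<alpha>| below that height. Then the errors in
  \<open>hol_discs_estimate\<close> are O(t), and the slope 821/1000 < sqrt (27/40) has room for
  them. In z1 the slope 1/6 matches the crude bound 6 on difference quotients.\<close>

lemma tent_diff_le:
  assumes \<phi>: "\<phi> \<in> hol_discs symmetrized_three_disc" and \<alpha>: "cmod \<alpha> < 1"
    and t: "0 \<le> t" "t \<le> 1 / 10 ^ 6"
  shows "tent t (\<phi> 0) - tent t (\<phi> \<alpha>) \<le> cmod \<alpha>"
proof -
  define c :: real where "c = 821 / 1000"
  define g where "g z = max (c * cmod (z $ 2 - of_real t)) (cmod (z $ 1) / 6)" for z :: "complex ^ 3"
  have h: "tent t z = max 0 (c * t - g z)" for z by (simp add: tent_def g_def c_def)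
  have g0: "0 \<le> g z" for z by (simp add: g_def c_def le_max_iff_disj)
  consider "c * t \<le> cmod \<alpha>" | "g (\<phi> 0) \<ge> c * t" | "cmod \<alpha> < c * t" "g (\<phi> 0) < c * t" by linarith
  then show ?thesis
  proof cases
    case 1
    then have "tent t (\<phi> 0) \<le> cmod \<alpha>"
      using g0[of "\<phi> 0"] unfolding h by (intro max.boundedI norm_ge_zero) linarith
    moreover have "0 \<le> tent t (\<phi> \<alpha>)" by (simp add: h)
    ultimately show ?thesis by linarith
  next
    case 2
    then have "tent t (\<phi> 0) = 0" by (simp add: h)
    moreover have "0 \<le> tent t (\<phi> \<alpha>)" by (simp add: h)
    ultimately show ?thesis using norm_ge_zero[of \<alpha>] by linarith
  next
    case 3
    define z w where "z = \<phi> 0" and "w = \<phi> \<alpha>"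
    have "c * cmod (z $ 2 - of_real t) < c * t" "cmod (z $ 1) < 6 * (c * t)"
      using 3(2) by (simp_all add: g_def z_def)
    then have z: "cmod (z $ 2 - of_real t) < t" "cmod (z $ 1) \<le> 6 * t"
      using t by (simp_all add: c_def)
    have "cmod (z $ 2) \<le> 6 * t"
      using z(1) t norm_triangle_ineq[of "z $ 2 - of_real t" "of_real t"] by simp
    then have e: "cmod (\<phi> 0 $ 1) \<le> 6 * t" "cmod (\<phi> 0 $ 2) \<le> 6 * t" using z by (simp_all add: z_def)
    obtain h where h2: "w $ 2 - z $ 2 = \<alpha> * h \<alpha>"
        "27 / 40 * (cmod (h \<alpha>))\<^sup>2 \<le> 1 + 40 * (6 * t) + 110 * cmod \<alpha>"
      using hol_discs_estimate[OF \<phi> e] \<alpha> unfolding z_def w_def by blast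
    have "cmod \<alpha> \<le> t" using 3(1) t by (simp add: c_def)
    \<comment> \<open>350 = 40 * 6 + 110, and (821/1000)^2 * (1 + 350 / 10^6) is still below
      27/40.\<close>
    then have "27 / 40 * (cmod (h \<alpha>))\<^sup>2 \<le> 1 + 350 * (1 / 10 ^ 6)" using h2(2) t by linarith
    then have "(c * cmod (h \<alpha>))\<^sup>2 \<le> 1\<^sup>2" unfolding power_mult_distrib c_def by (simp add: power2_eq_square)
    then have "c * cmod (h \<alpha>) \<le> 1" by (rule power2_le_imp_le) simp
    then have "cmod \<alpha> * (c * cmod (h \<alpha>)) \<le> cmod \<alpha> * 1" by (rule mult_left_mono) simp
    then have 2: "c * cmod (w $ 2 - z $ 2) \<le> cmod \<alpha>" unfolding h2(1) by (simp add: norm_mult mult.left_commute)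
    have 1: "cmod (w $ 1 - z $ 1) / 6 \<le> cmod \<alpha>"
    proof -
      obtain k where "w $ 1 - z $ 1 = \<alpha> * k \<alpha>" "cmod (k \<alpha>) \<le> 6"
        using hol_discs_difference_quotient[OF \<phi>, of 1] \<alpha> unfolding z_def w_def by blast
      then show ?thesis using mult_left_mono[of "cmod (k \<alpha>)" 6 "cmod \<alpha>"] by (simp add: norm_mult)
    qed
    have "c * cmod (w $ 2 - of_real t) \<le> c * cmod (z $ 2 - of_real t) + c * cmod (w $ 2 - z $ 2)"
      using norm_triangle_ineq[of "z $ 2 - of_real t" "w $ 2 - z $ 2"] by (simp add: c_def)
    moreover have "cmod (w $ 1) / 6 \<le> cmod (z $ 1) / 6 + cmod (w $ 1 - z $ 1) / 6"
      using norm_triangle_ineq[of "z $ 1" "w $ 1 - z $ 1"] by simp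
    moreover have "c * cmod (z $ 2 - of_real t) \<le> g z" "cmod (z $ 1) / 6 \<le> g z"
      by (simp_all add: g_def)
    ultimately have "g w \<le> g z + cmod \<alpha>"
      unfolding g_def[of w] using 1 2 by (intro max.boundedI) linarith+
    moreover have "tent t z = c * t - g z" "c * t - g w \<le> tent t w"
      using 3(2) by (simp_all add: h z_def)
    ultimately show ?thesis unfolding z_def w_def by linarith
  qed
qed


text \<open>The disc automorphism exchanging 0 and \<alpha> makes the one-sided estimate for
  \<open>tent\<close> two-sided.\<close>

lemma hol_discs_reverse:
  assumes \<phi>: "\<phi> \<in> hol_discs D" and \<alpha>: "cmod \<alpha> < 1"
  obtains \<psi> where "\<psi> \<in> hol_discs D" "\<psi> 0 = \<phi> \<alpha>" "\<psi> \<alpha> = \<phi> 0"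
proof -
  define m where "m \<zeta> = - Moebius_function 0 \<alpha> \<zeta>" for \<zeta>
  have hol: "m holomorphic_on ball 0 1"
    unfolding m_def by (intro holomorphic_intros Moebius_function_holomorphic \<alpha>)
  have m: "m ` ball 0 1 \<subseteq> ball 0 1"
    using Moebius_function_norm_lt_1[OF \<alpha>] by (auto simp: m_def)
  have "(\<lambda>\<zeta>. \<phi> (m \<zeta>)) \<in> hol_discs D"
    unfolding hol_discs_def mem_Collect_eq
  proof (intro conjI allI)
    fix i
    have "(\<lambda>\<zeta>. \<phi> \<zeta> $ i) holomorphic_on ball 0 1" using \<phi> by (simp add: hol_discs_def)
    from holomorphic_on_compose_gen[OF hol this m]
    show "(\<lambda>\<zeta>. \<phi> (m \<zeta>) $ i) holomorphic_on ball 0 1" by (simp add: o_def)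
    show "(\<lambda>\<zeta>. \<phi> (m \<zeta>)) ` ball 0 1 \<subseteq> D" using \<phi> m unfolding hol_discs_def by blast
  qed
  moreover have "m 0 = \<alpha>" "m \<alpha> = 0"
    by (simp_all add: m_def Moebius_function_of_zero Moebius_function_eq_zero)
  ultimately show thesis using that by simp
qed

lemma tent_le_lempert:
  assumes t: "0 \<le> t" "t \<le> 1 / 10 ^ 6"
  shows "ennreal \<bar>tent t z - tent t w\<bar> \<le> lempert symmetrized_three_disc z w"
  unfolding lempert_def
proof (rule Inf_greatest)
  fix y assume "y \<in> {ennreal (artanh (cmod \<alpha>)) |\<alpha>. \<alpha> \<in> unit_disc \<and>
      (\<exists>\<phi>\<in>hol_discs symmetrized_three_disc. \<phi> 0 = z \<and> \<phi> \<alpha> = w)}"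
  then obtain \<alpha> \<phi> where y: "y = ennreal (artanh (cmod \<alpha>))" and \<alpha>: "cmod \<alpha> < 1"
    and \<phi>: "\<phi> \<in> hol_discs symmetrized_three_disc" "\<phi> 0 = z" "\<phi> \<alpha> = w" by auto
  obtain \<psi> where \<psi>: "\<psi> \<in> hol_discs symmetrized_three_disc" "\<psi> 0 = w" "\<psi> \<alpha> = z"
    using hol_discs_reverse[OF \<phi>(1) \<alpha>] \<phi>(2,3) by metis
  have "\<bar>tent t z - tent t w\<bar> \<le> cmod \<alpha>"
    using tent_diff_le[OF \<phi>(1) \<alpha> t] tent_diff_le[OF \<psi>(1) \<alpha> t] \<phi>(2,3) \<psi>(2,3) by simp
  also have "\<dots> \<le> artanh (cmod \<alpha>)" using \<alpha> by (intro le_artanh) auto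
  finally show "ennreal \<bar>tent t z - tent t w\<bar> \<le> y" unfolding y by (rule ennreal_leI)
qed

lemma tent_le_kobayashi:
  assumes "0 \<le> t" "t \<le> 1 / 10 ^ 6"
  shows "ennreal \<bar>tent t z - tent t w\<bar> \<le> kobayashi symmetrized_three_disc z w"
proof -
  let ?d = "\<lambda>z w. ennreal \<bar>tent t z - tent t w\<bar>"
  have "pseudodistance_on symmetrized_three_disc ?d"
    unfolding pseudodistance_on_def
    by (auto simp: abs_minus_commute simp flip: ennreal_plus intro!: ennreal_leI)
  then show ?thesis
    unfolding kobayashi_eq_SUP
    by (intro SUP_upper2[of ?d]) (auto intro: tent_le_lempert[OF assms])
qed

text \<open>On the z2 axis \<open>f\<close> is a function of one variable with derivative at most
  4505/5488 at 0, and 4 t^2 bounds its Taylor remainder. The form x / (1 - x) is a rational majorant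
  of artanh.\<close>

lemma caratheodory_axis_2_le:
  assumes t: "0 < t" "t < 1"  and x: "4505 / 5488 * t + 4 * t\<^sup>2 \<le> x" "x < 1"
  shows "caratheodory symmetrized_three_disc 0 (vector [0, of_real t, 0]) \<le> ennreal (x / (1 - x))"
  unfolding caratheodory_def
proof (rule Sup_least)
  fix y assume "y \<in> {ennreal (artanh (cmod (f (vector [0, complex_of_real t, 0])))) |f.
      f \<in> hol_to_disc symmetrized_three_disc \<and> f 0 = 0}"
  then obtain f where y: "y = ennreal (artanh (cmod (f (vector [0, complex_of_real t, 0]))))"
    and f: "f \<in> hol_to_disc symmetrized_three_disc" "f 0 = 0" by blast
  define g where "g \<xi> = f (vector [0, \<xi>, 0])" for \<xi>
  have g: "g holomorphic_on ball 0 1"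
    unfolding g_def by (rule hol_to_disc_compose(1)[OF f(1) open_ball])
      (auto intro!: vector_3_holomorphic holomorphic_intros symmetrized_three_disc_axis_2)
  have g0: "g 0 = 0" using f(2) by (simp add: g_def zero_eq_vector_3)
  have "deriv g 0 = frechet_derivative f (at (vector [0, 0, 0]))
      (disc_deriv (\<lambda>\<xi>. vector [0, \<xi>, 0]) 0)"
    unfolding g_def by (rule hol_to_disc_compose(2)[OF f(1) open_ball[of 0 1]])
      (auto intro!: vector_3_holomorphic holomorphic_intros symmetrized_three_disc_axis_2)
  also have "disc_deriv (\<lambda>\<xi>. vector [0, \<xi>, 0]) 0 = (axis 2 1 :: complex ^ 3)"
    by (simp add: disc_deriv_def vec_eq_iff forall_3 axis_def)
  finally have dg: "cmod (deriv g 0) \<le> 4505 / 5488"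
    using frechet_derivative_symmetrized_three_disc[OF f] by (simp add: zero_eq_vector_3)
  have gt: "cmod (of_real t) < 1" using t by simp
  have "cmod (g (of_real t) - g 0 - deriv g 0 * of_real t) \<le> 4 * 1 * (cmod (of_real t))\<^sup>2"
    using Taylor_remainder_unit_disc[OF g _ gt, of 1]
      hol_to_disc_frechet(3)[OF f(1) symmetrized_three_disc_axis_2] by (force simp: g_def)
  then have "cmod (g (of_real t)) \<le> cmod (deriv g 0 * of_real t) + 4 * t\<^sup>2"
    using norm_triangle_sub[of "g (of_real t)" "deriv g 0 * of_real t"] g0 t by simp
  also have "\<dots> \<le> 4505 / 5488 * t + 4 * t\<^sup>2"
    using mult_right_mono[OF dg, of t] t by (simp add: norm_mult)
  finally have le: "cmod (g (of_real t)) \<le> x" using x by linarith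
  then have "artanh (cmod (g (of_real t))) \<le> cmod (g (of_real t)) / (1 - cmod (g (of_real t)))"
    using x by (intro artanh_le) auto
  also have "\<dots> \<le> x / (1 - x)" using le x order_trans[OF norm_ge_zero le] by (intro frac_le) auto
  finally show "y \<le> ennreal (x / (1 - x))" unfolding y g_def by (rule ennreal_leI)
qed

lemma caratheodory_reiffen_axis_2_le:
  "caratheodory_reiffen symmetrized_three_disc 0 (axis 2 1) \<le> ennreal (4505 / 5488)"
  unfolding caratheodory_reiffen_def
  by (rule Sup_least) (auto intro!: ennreal_leI frechet_derivative_symmetrized_three_disc)

theorem proposition5:
  "reiffen_hat 2 symmetrized_three_disc 0 (axis 2 1) >
     caratheodory_reiffen symmetrized_three_disc 0 (axis 2 1) \<and>
   kobayashi_buseman symmetrized_three_disc 0 (axis 2 1) >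
     caratheodory_reiffen symmetrized_three_disc 0 (axis 2 1) \<and>
   (\<exists>w\<in>symmetrized_three_disc.
      kobayashi symmetrized_three_disc 0 w \<noteq> caratheodory symmetrized_three_disc 0 w)"
proof (intro conjI)
  let ?N = "\<lambda>X :: complex ^ 3. ennreal (sqrt (27 / 40) * cmod (X $ 2))"
  have N: "pseudonorm ?N" by (rule pseudonorm_component) simp
  have "4505 / 5488 < sqrt (27 / 40 :: real)" by (rule real_less_rsqrt) (simp add: power2_eq_square)
  then have "ennreal (4505 / 5488) < ?N (axis 2 1)"
    by (simp add: axis_def ennreal_lessI)
  then have less: "caratheodory_reiffen symmetrized_three_disc 0 (axis 2 1) < ?N (axis 2 1)"
    by (rule le_less_trans[OF caratheodory_reiffen_axis_2_le])
  show "caratheodory_reiffen symmetrized_three_disc 0 (axis 2 1)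
      < reiffen_hat 2 symmetrized_three_disc 0 (axis 2 1)"
    unfolding reiffen_hat_def
    by (rule less_le_trans[OF less le_largest_pseudonorm[OF N component_le_reiffen]])
  show "caratheodory_reiffen symmetrized_three_disc 0 (axis 2 1)
      < kobayashi_buseman symmetrized_three_disc 0 (axis 2 1)"
    unfolding kobayashi_buseman_def
    by (rule less_le_trans[OF less le_largest_pseudonorm[OF N component_le_kobayashi_royden]])
  \<comment> \<open>8209/10000 lies between 4505/5488 and 821/1000: the first gap absorbs 4 t^2, the
    second the excess of x / (1 - x) over x.\<close>
  define t :: real where "t = 1 / 10 ^ 6"
  define x :: real where "x = 8209 / 10000 * t"
  let ?w = "vector [0, of_real t, 0] :: complex ^ 3"
  have "caratheodory symmetrized_three_disc 0 ?w \<le> ennreal (x / (1 - x))"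
    by (rule caratheodory_axis_2_le) (simp_all add: x_def t_def power2_eq_square)
  also have "\<dots> < ennreal (821 / 1000 * t)"
    by (rule ennreal_lessI) (simp_all add: x_def t_def)
  \<comment> \<open>The tent vanishes at 0 and has its peak at \<open>?w\<close>.\<close>
  also have "\<dots> = ennreal \<bar>tent t 0 - tent t ?w\<bar>"
    by (simp add: tent_def t_def)
  also have "\<dots> \<le> kobayashi symmetrized_three_disc 0 ?w"
    by (rule tent_le_kobayashi) (simp_all add: t_def)
  finally have "kobayashi symmetrized_three_disc 0 ?w \<noteq> caratheodory symmetrized_three_disc 0 ?w" by simp
  moreover have "?w \<in> symmetrized_three_disc"
    by (rule symmetrized_three_disc_axis_2) (simp add: t_def)
  ultimately show "\<exists>w\<in>symmetrized_three_disc.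
      kobayashi symmetrized_three_disc 0 w \<noteq> caratheodory symmetrized_three_disc 0 w" by blast
qed

end
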